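(* Let $n,k$ be integers with $2\leq k\leq n-17$, and let $G$ be a connected graph of order $n$ (so $n\geq k+17$) with minimum degree $\delta\geq k+1$. If $$M_{1}(\overline{G})\leq(n-k)[3(n-k)-11],$$ then $G$ is $k$-leaf-connected unless the closure $C_{n+k-1}(G)$ is (isomorphic to) a member of $\{K_{k}\vee (K_{n-k-2}+K_{2}),\ K_{3}\vee (K_{n-5}+2K_{1})\}$.
   Context: All graphs are finite, simple and undirected; the order of $G$ is $|V(G)|$. $d_G(v)$ is the degree of the vertex $v$ in $G$, $\delta=\delta(G)$ is the minimum degree, and $\overline{G}$ is the complement of $G$. The first Zagreb index of a graph $H$ is $M_{1}(H)=\sum_{v\in V(H)}d_{H}(v)^{2}$. For $k\geq 2$, a graph $G$ with $|V(G)|\geq k+1$ is $k$-leaf-connected if for every subset $S\subseteq V(G)$ with $|S|=k$, $G$ has a spanning tree $T$ such that $S$ is precisely the set of leaves of $T$. For an integer $l\geq 0$, the $l$-closure $C_l(G)$ of $G$ is the graph obtained from $G$ by successively joining pairs of nonadjacent vertices whose degree sum (in the current graph) is at least $l$, until no such pair exists. For vertex-disjoint graphs $G$ and $H$, $G+H$ is their disjoint union, $tG$ is the disjoint union of $t$ copies of $G$, and the join $G\vee H$ is obtained from $G+H$ by adding all possible edges between $V(G)$ and $V(H)$. $K_n$ is the complete graph of order $n$. *)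

theory Defs
  imports "Graph_Theory.Graph_Theory"
begin

text \<open>
  A finite simple undirected graph is a \<^locale>\<open>pair_graph\<close>: a finite loopless symmetric digraph
  without parallel arcs, every edge $uv$ being the two arcs $(u,v)$ and $(v,u)$. Hence the degree
  of a vertex is its out-degree.
\<close>

abbreviation degree :: "'a pair_pre_digraph \<Rightarrow> 'a \<Rightarrow> nat" where
  "degree G v \<equiv> out_degree (with_proj G) v"

definition min_degree :: "'a pair_pre_digraph \<Rightarrow> nat" where
  "min_degree G = Min (degree G ` pverts G)"

definition complement_graph :: "'a pair_pre_digraph \<Rightarrow> 'a pair_pre_digraph" where
  "complement_graph G =
     \<lparr>pverts = pverts G,
      parcs = {(u, v). u \<in> pverts G \<and> v \<in> pverts G \<and> u \<noteq> v \<and> (u, v) \<notin> parcs G}\<rparr>"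

definition first_Zagreb :: "'a pair_pre_digraph \<Rightarrow> nat" where
  "first_Zagreb H = (\<Sum>v\<in>pverts H. (degree H v)\<^sup>2)"


text \<open>
  The library's \<^const>\<open>forest\<close> and \<^const>\<open>tree\<close> forbid all directed cycles, hence also the closed
  walk $u,v,u$ along a single edge. A cycle of an undirected graph is a directed cycle of length at
  least 3.
\<close>

definition undirected_tree :: "'a pair_pre_digraph \<Rightarrow> bool" where
  "undirected_tree T \<longleftrightarrow> pair_graph T \<and> connected (with_proj T) \<and>
     \<not> (\<exists>p. pre_digraph.cycle (with_proj T) p \<and> 3 \<le> length p)"

definition leaves :: "'a pair_pre_digraph \<Rightarrow> 'a set" where
  "leaves T = {v \<in> pverts T. degree T v = 1}"

definition k_leaf_connected :: "nat \<Rightarrow> 'a pair_pre_digraph \<Rightarrow> bool" where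
  "k_leaf_connected k G \<longleftrightarrow> k + 1 \<le> card (pverts G) \<and>
     (\<forall>S \<subseteq> pverts G. card S = k \<longrightarrow>
        (\<exists>T. undirected_tree T \<and> spanning (with_proj T) (with_proj G) \<and> leaves T = S))"


definition add_edge :: "'a \<Rightarrow> 'a \<Rightarrow> 'a pair_pre_digraph \<Rightarrow> 'a pair_pre_digraph" where
  "add_edge u v G = \<lparr>pverts = pverts G, parcs = parcs G \<union> {(u, v), (v, u)}\<rparr>"

inductive closure_step :: "nat \<Rightarrow> 'a pair_pre_digraph \<Rightarrow> 'a pair_pre_digraph \<Rightarrow> bool" for l where
  "\<lbrakk>u \<in> pverts G; v \<in> pverts G; u \<noteq> v; (u, v) \<notin> parcs G; l \<le> degree G u + degree G v\<rbrakk>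
     \<Longrightarrow> closure_step l G (add_edge u v G)"

definition is_l_closure :: "nat \<Rightarrow> 'a pair_pre_digraph \<Rightarrow> 'a pair_pre_digraph \<Rightarrow> bool" where
  "is_l_closure l G H \<longleftrightarrow> (closure_step l)\<^sup>*\<^sup>* G H \<and> \<not> (\<exists>H'. closure_step l H H')"

text \<open>Well-defined for every \<^locale>\<open>pair_graph\<close>, see \<open>ex1_l_closure\<close> below.\<close>

definition l_closure :: "nat \<Rightarrow> 'a pair_pre_digraph \<Rightarrow> 'a pair_pre_digraph" where
  "l_closure l G = (THE H. is_l_closure l G H)"

lemma pair_graph_add_edge:
  assumes "pair_graph G" "u \<in> pverts G" "v \<in> pverts G" "u \<noteq> v"
  shows "pair_graph (add_edge u v G)"
proof -
  interpret pair_graph G by fact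
  have eqs: "pverts (add_edge u v G) = pverts G"
    "parcs (add_edge u v G) = insert (u, v) (insert (v, u) (parcs G))"
    by (auto simp: add_edge_def)
  have sym: "sym (parcs (add_edge u v G))"
    unfolding eqs by (rule symI) (auto dest: arcs_symmetric)
  show ?thesis
  proof unfold_locales
    fix e assume e: "e \<in> parcs (add_edge u v G)"
    then show "fst e \<in> pverts (add_edge u v G)" "snd e \<in> pverts (add_edge u v G)"
      using assms(2,3) arc_fst_in_verts[of e] arc_snd_in_verts[of e] unfolding eqs by auto
    show "fst e \<noteq> snd e"
      using e assms(4) pair_no_loops[of e] unfolding eqs by auto
  qed (use sym in \<open>simp_all add: eqs pair_finite_verts pair_finite_arcs symmetric_def\<close>)
qed

lemma closure_steps_pair_graph:
  assumes "(closure_step l)\<^sup>*\<^sup>* G H" "pair_graph G"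
  shows "pair_graph H \<and> pverts H = pverts G"
  using assms
proof (induction rule: rtranclp_induct)
  case (step H H')
  from step.hyps(2) show ?case
  proof cases
    case (1 u v)
    moreover have "pverts (add_edge u v H) = pverts H" by (simp add: add_edge_def)
    ultimately show ?thesis
      using pair_graph_add_edge[of H u v] step.IH[OF step.prems] by simp
  qed
qed simp

lemma degree_mono:
  assumes "pair_graph C" "parcs H \<subseteq> parcs C"
  shows "degree H v \<le> degree C v"
proof -
  interpret pair_graph C by fact
  show ?thesis
    unfolding out_degree_def out_arcs_def
    using assms(2) pair_finite_arcs by (intro card_mono) auto
qed

lemma closure_steps_subset_closed:
  assumes "(closure_step l)\<^sup>*\<^sup>* G H" "pair_graph C" "pverts C = pverts G" "parcs G \<subseteq> parcs C"
    and closed: "\<not> (\<exists>C'. closure_step l C C')" and G: "pair_graph G"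
  shows "parcs H \<subseteq> parcs C"
  using assms(1)
proof (induction rule: rtranclp_induct)
  case (step H H')
  then have vH: "pverts H = pverts C"
    using closure_steps_pair_graph[OF step.hyps(1) G] assms(3) by simp
  interpret C: pair_graph C by fact
  from step.hyps(2) show ?case
  proof cases
    case (1 u v)
    have "l \<le> degree C u + degree C v"
      using 1 degree_mono[OF assms(2) step.IH, of u] degree_mono[OF assms(2) step.IH, of v]
      by linarith
    then have "(u, v) \<in> parcs C"
      using closed closure_step.intros[of u C v l] 1 vH by blast
    then show ?thesis
      using 1 step.IH C.arcs_symmetric by (auto simp: add_edge_def)
  qed
qed (use assms(4) in simp)

lemma closure_steps_mono: "(closure_step l)\<^sup>*\<^sup>* G H \<Longrightarrow> parcs G \<subseteq> parcs H"
  by (induction rule: rtranclp_induct) (auto elim!: closure_step.cases simp: add_edge_def)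

lemma ex_l_closure:
  assumes "pair_graph G"
  shows "\<exists>H. is_l_closure l G H"
  using assms
proof (induction "card (pverts G \<times> pverts G - parcs G)" arbitrary: G rule: less_induct)
  case less
  show ?case
  proof (cases "\<exists>G'. closure_step l G G'")
    case False
    then show ?thesis by (auto simp: is_l_closure_def)
  next
    case True
    then obtain G' where G': "closure_step l G G'" by blast
    interpret pair_graph G by fact
    have pg: "pair_graph G'" using closure_steps_pair_graph[of l G G'] G' less.prems by blast
    have "pverts G' \<times> pverts G' - parcs G' \<subset> pverts G \<times> pverts G - parcs G"
      using G' by cases (auto simp: add_edge_def)
    then have "card (pverts G' \<times> pverts G' - parcs G') < card (pverts G \<times> pverts G - parcs G)"
      using pair_finite_verts by (intro psubset_card_mono) auto
    from less.hyps[OF this pg] obtain H where "is_l_closure l G' H" by blast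
    then show ?thesis
      using G' unfolding is_l_closure_def by (meson converse_rtranclp_into_rtranclp)
  qed
qed

lemma ex1_l_closure:
  assumes "pair_graph G"
  shows "\<exists>!H. is_l_closure l G H"
proof (rule ex_ex1I[OF ex_l_closure[OF assms]])
  fix H K assume H: "is_l_closure l G H" and K: "is_l_closure l G K"
  note pH = closure_steps_pair_graph[of l G H] and pK = closure_steps_pair_graph[of l G K]
  have "parcs H \<subseteq> parcs K"
    using H K pK closure_steps_mono[of l G K] closure_steps_subset_closed[of l G H K] assms
    unfolding is_l_closure_def by simp
  moreover have "parcs K \<subseteq> parcs H"
    using H K pH closure_steps_mono[of l G H] closure_steps_subset_closed[of l G K H] assms
    unfolding is_l_closure_def by simp
  ultimately show "H = K"
    using H K pH pK assms unfolding is_l_closure_def by (intro pair_pre_digraph.equality) auto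
qed


definition complete_graph :: "nat \<Rightarrow> nat pair_pre_digraph" where
  "complete_graph n = \<lparr>pverts = {..<n}, parcs = {(u, v). u < n \<and> v < n \<and> u \<noteq> v}\<rparr>"

definition graph_sum :: "'a pair_pre_digraph \<Rightarrow> 'b pair_pre_digraph \<Rightarrow> ('a + 'b) pair_pre_digraph" where
  "graph_sum G H =
     \<lparr>pverts = pverts G <+> pverts H,
      parcs = map_prod Inl Inl ` parcs G \<union> map_prod Inr Inr ` parcs H\<rparr>"

definition graph_copies :: "nat \<Rightarrow> 'a pair_pre_digraph \<Rightarrow> (nat \<times> 'a) pair_pre_digraph" where
  "graph_copies t G =
     \<lparr>pverts = {..<t} \<times> pverts G,
      parcs = {((i, u), (j, v)). i < t \<and> i = j \<and> (u, v) \<in> parcs G}\<rparr>"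

definition graph_join :: "'a pair_pre_digraph \<Rightarrow> 'b pair_pre_digraph \<Rightarrow> ('a + 'b) pair_pre_digraph" where
  "graph_join G H =
     \<lparr>pverts = pverts (graph_sum G H),
      parcs = parcs (graph_sum G H) \<union> (Inl ` pverts G) \<times> (Inr ` pverts H)
                \<union> (Inr ` pverts H) \<times> (Inl ` pverts G)\<rparr>"

lemma complete_digraph_complete_graph: "K\<^bsub>n\<^esub> (with_proj (complete_graph n))"
  by (auto simp: complete_digraph_pair_def complete_graph_def)

text \<open>Between pair graphs, \<^const>\<open>digraph_iso\<close> is ordinary isomorphism of simple graphs.\<close>

lemma digraph_iso_pair_iff:
  assumes "pair_wf_digraph G"
  shows "digraph_iso (with_proj G) (with_proj H) \<longleftrightarrow>
    (\<exists>f. bij_betw f (pverts G) (pverts H) \<and> parcs H = map_prod f f ` parcs G)"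
proof
  assume "digraph_iso (with_proj G) (with_proj H)"
  then obtain h where iso: "pre_digraph.digraph_isomorphism (with_proj G) h"
    and H: "with_proj H = app_iso h (with_proj G)"
    by (auto simp: digraph_iso_def)
  from H have eqs: "pverts H = iso_verts h ` pverts G" "parcs H = iso_arcs h ` parcs G"
    "iso_tail h = fst" "iso_head h = snd"
    by (simp_all add: with_proj_def app_iso_def)
  have "iso_arcs h a = map_prod (iso_verts h) (iso_verts h) a" if "a \<in> parcs G" for a
    using iso that eqs(3,4) unfolding pre_digraph.digraph_isomorphism_def
    by (auto simp: prod_eq_iff)
  moreover have "inj_on (iso_verts h) (pverts G)"
    using iso unfolding pre_digraph.digraph_isomorphism_def by simp
  ultimately show "\<exists>f. bij_betw f (pverts G) (pverts H) \<and> parcs H = map_prod f f ` parcs G"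
    using eqs by (intro exI[of _ "iso_verts h"]) (auto simp: bij_betw_def image_def)
next
  interpret pair_wf_digraph G by fact
  assume "\<exists>f. bij_betw f (pverts G) (pverts H) \<and> parcs H = map_prod f f ` parcs G"
  then obtain f where f: "inj_on f (pverts G)" "pverts H = f ` pverts G"
    "parcs H = map_prod f f ` parcs G"
    by (auto simp: bij_betw_def)
  let ?h = "\<lparr>iso_verts = f, iso_arcs = map_prod f f, iso_head = snd, iso_tail = fst\<rparr>"
  have "inj_on (map_prod f f) (pverts G \<times> pverts G)"
    using f(1) by (auto simp: inj_on_def)
  moreover have "parcs G \<subseteq> pverts G \<times> pverts G"
    using arc_fst_in_verts arc_snd_in_verts by force
  ultimately have "inj_on (map_prod f f) (parcs G)"
    by (rule inj_on_subset)
  then have "pre_digraph.digraph_isomorphism (with_proj G) ?h"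
    using f(1) assms unfolding pre_digraph.digraph_isomorphism_def
    by (auto simp: wf_digraph_wp_iff)
  moreover have "with_proj H = app_iso ?h (with_proj G)"
    using f by (simp add: with_proj_def app_iso_def)
  ultimately show "digraph_iso (with_proj G) (with_proj H)"
    unfolding digraph_iso_def by blast
qed

end

theory Submission
  imports Defs
begin

text \<open>
  Write $V$ for the vertex set and $m = n - k \<ge> 17$. The \<^emph>\<open>codegree\<close> of a vertex is its degree in the
  complement.
  
  \<^bold>\<open>From leaves to Hamiltonian paths.\<close> Let $S$ be a set of $k$ vertices that is not the leaf set of a spanning
  tree, and split it as $S = \{a, b\} \cup R$. A Hamiltonian path of $G - R$ from $a$ to $b$ would give such a
  tree: every $s \in R$ has more than $k$ neighbours, so one outside $S$, and can be hung onto an inner vertex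
  of the path (\<open>tree_of_hamiltonian_path\<close>). So $G - R$ has no such path. Deleting the $k - 2$
  vertices of $R$ lowers a degree sum by at most $2(k - 2)$, so a pair joined in forming the closure
  $H = C_{n+k-1}(G)$ has degree sum at least $|V - R| + 1$ in $G - R$ at that moment; the crossing
  argument of Bondy and Chvatal then shows that $H - R$ has no Hamiltonian path from $a$ to $b$ either
  (\<open>hamiltonian_path_of_closure\<close>).
  
  \<^bold>\<open>Two vertices of codegree $m - 2$.\<close> Complete $H - R$ to a maximal graph without such a path. Its
  nonadjacent pair of least codegree sum $p + q$, $q \<le> p$, satisfies $p + q \<ge> m$ and forces $q$ vertices of
  codegree at least $p$ and $p + 1$ vertices of codegree at least $q$ (\<open>non_hamiltonian_codegrees\<close>).
  Since $\delta \<ge> k + 1$ gives $p \<le> m - 2$, the bound $M_1(\overline{G}) \<le> m(3m - 11)$ leaves only $q = 2$,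
  $p = m - 2$ (\<open>zagreb_bound_int\<close>). So $H$ has two vertices $x$, $y$ of codegree $m - 2$, the
  largest possible value, and all their non-neighbours avoid $R$.
  
  \<^bold>\<open>The closure.\<close> Nonadjacent vertices of $H$ have codegree sum at least $m$, so $M_1 \<ge> m \cdot e$ for the
  number $e$ of edges of $\overline{H}$, and $e \<le> 3m - 11$. An edge $uv$ of $\overline{H}$ avoiding $x$ and $y$ would give
  $e \<ge> 2(m - 2) + m - 6$. So every edge of $\overline{H}$ meets $\{x, y\}$, and every other
  vertex of positive codegree is nonadjacent in $H$ to exactly $x$ and $y$ (\<open>two_extreme_codegrees_structure\<close>).
  Let $W$ be the set of these vertices and $C$ the set of vertices of codegree 0. If $xy$ is an edge of $H$, then $|C| = k$ and
  $H = K_k \<or> (K_{n-k-2} + K_2)$. Otherwise $|C| = k + 1$ and $H = K_{k+1} \<or> (K_{n-k-3} + 2K_1)$, which for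
  $k = 2$ is the second exception.
  
  \<^bold>\<open>The graph $K_{k+1} \<or> (K_{n-k-3} + 2K_1)$ for $k \<ge> 3$.\<close> Here the choice of $R$ matters: the non-neighbours
  of $x$ and $y$ avoid every $(k - 2)$-subset of $S$, and these cover $S$, so $S \<subseteq> C$ and $C = S \cup \{c\}$.
  Hanging leaves onto a Hamiltonian path cannot produce the leaf set $S$ now, but a spider with centre $c$ and three legs
  through $x$, $y$ and $W$ does, with the rest of $S$ hung onto $x$ (\<open>spider_tree\<close>).
\<close>

section \<open>Hamiltonian paths with prescribed ends\<close>

definition hamiltonian_path :: "'a rel \<Rightarrow> 'a set \<Rightarrow> 'a \<Rightarrow> 'a \<Rightarrow> bool" where
  "hamiltonian_path A U a b \<longleftrightarrow>
     (\<exists>p. distinct p \<and> p \<noteq> [] \<and> set p = U \<and> hd p = a \<and> last p = b \<and> successively (\<lambda>u v. (u, v) \<in> A) p)"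

lemma hamiltonian_path_complete:
  assumes "finite U" "a \<in> U" "b \<in> U" "a \<noteq> b" "\<And>u v. u \<in> U \<Longrightarrow> v \<in> U \<Longrightarrow> u \<noteq> v \<Longrightarrow> (u, v) \<in> A"
  shows "hamiltonian_path A U a b"
proof -
  obtain xs where xs: "set xs = U - {a, b}" "distinct xs"
    using finite_distinct_list[of "U - {a, b}"] assms(1) by auto
  let ?p = "a # xs @ [b]"
  have "distinct ?p" using xs assms by auto
  have "successively (\<lambda>u v. (u, v) \<in> A) ?p"
    unfolding successively_conv_nth
  proof (intro allI impI)
    fix i assume i: "Suc i < length ?p"
    have "?p ! i \<noteq> ?p ! Suc i"
      using nth_eq_iff_index_eq[OF \<open>distinct ?p\<close>, of i "Suc i"] i by simp
    moreover have "?p ! i \<in> U" "?p ! Suc i \<in> U"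
      using nth_mem[of i ?p] nth_mem[of "Suc i" ?p] i xs assms by auto
    ultimately show "(?p ! i, ?p ! Suc i) \<in> A" using assms by blast
  qed
  then show ?thesis
    unfolding hamiltonian_path_def using \<open>distinct ?p\<close> xs assms by (intro exI[of _ ?p]) auto
qed

lemma card_positions:
  assumes "distinct q"
  shows "card {i. i < length q \<and> q ! i \<in> X} = card (X \<inter> set q)"
proof -
  have "bij_betw (\<lambda>i. q ! i) {i. i < length q \<and> q ! i \<in> X} (X \<inter> set q)"
    using assms by (auto simp: bij_betw_def inj_on_def nth_eq_iff_index_eq in_set_conv_nth)
  then show ?thesis by (rule bij_betw_same_card)
qed

text \<open>
  The path runs from $a$ through \<open>xs\<close>, along the new edge from $u$ to $v$, and through \<open>ys\<close> to $b$. If some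
  vertex of the path is a neighbour of $u$ and its successor is a neighbour of $v$, then replacing the edge $uv$
  and the edge between these two by their connections to $u$ and $v$, and reversing the part in between,
  gives a Hamiltonian path without the new edge. Such a consecutive pair exists by counting positions. The
  usual bound $|U| + 1$ drops to $|U|$ if $u$ or $v$ is an end of the path.
\<close>

lemma crossing_oriented:
  assumes "sym A" "irrefl A" "(u, v) \<notin> A"
    and p: "distinct (xs @ u # v # ys)" "set (xs @ u # v # ys) = U"
    and ends: "hd (xs @ u # v # ys) = a" "last (xs @ u # v # ys) = b"
    and left: "successively (\<lambda>u v. (u, v) \<in> A) (xs @ [u])"
    and right: "successively (\<lambda>u v. (u, v) \<in> A) (v # ys)"
    and deg: "card U + 1 \<le> card (A `` {u} \<inter> U) + card (A `` {v} \<inter> U)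
                + (if u = a \<or> v = b then 1 else 0)"
    and not_both: "\<not> (u = a \<and> v = b)"
  shows "hamiltonian_path A U a b"
proof -
  let ?p = "xs @ u # v # ys" and ?j = "length xs"
  define m where "m = length xs + length ys + 1"
  have len: "length ?p = Suc m" by (simp add: m_def)
  define I where "I = {i. i < m \<and> ?p ! i \<in> A `` {u}}"
  define J where "J = {i. i < m \<and> ?p ! Suc i \<in> A `` {v}}"
  have cardU: "card U = Suc m" using distinct_card[OF p(1)] p(2) len by simp
  have bl: "butlast ?p = xs @ butlast (u # v # ys)" by (simp add: butlast_append)
  have "I = {i. i < length (butlast ?p) \<and> butlast ?p ! i \<in> A `` {u}}"
    using len by (auto simp: I_def nth_butlast)
  then have "card I = card (A `` {u} \<inter> set (butlast ?p))"
    using card_positions[of "butlast ?p" "A `` {u}"] p(1) distinct_butlast by metis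
  moreover have "set (butlast ?p) = U - {b}"
  proof -
    have split: "?p = butlast ?p @ [b]" using ends(2) append_butlast_last_id[of ?p] by auto
    have "distinct (butlast ?p @ [b])" "set (butlast ?p @ [b]) = U"
      using p unfolding split[symmetric] by auto
    then show ?thesis by auto
  qed
  ultimately have cI: "card I = card (A `` {u} \<inter> U - {b})" by (simp add: Int_Diff)
  have "J = {i. i < length (tl ?p) \<and> tl ?p ! i \<in> A `` {v}}"
    using len by (auto simp: J_def nth_tl)
  then have "card J = card (A `` {v} \<inter> set (tl ?p))"
    using card_positions[of "tl ?p" "A `` {v}"] p(1) distinct_tl by metis
  moreover have "set (tl ?p) = U - {a}"
  proof -
    have "?p = a # tl ?p" using ends(1) by (cases ?p) auto
    then show ?thesis using p by (metis Diff_insert_absorb distinct.simps(2) list.simps(15))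
  qed
  ultimately have cJ: "card J = card (A `` {v} \<inter> U - {a})" by (simp add: Int_Diff)
  have finU: "finite U" using p(2) by auto
  have "(v, u) \<notin> A" using assms(1,3) by (meson symD)
  \<comment> \<open>At most one neighbour of each of $u$, $v$ is lost at the ends, and none of $v$ (of $u$) if the
    end in question is $u$ (is $v$), because $u$ and $v$ are not adjacent.\<close>
  have "card (A `` {u} \<inter> U) \<le> card I + (if v = b then 0 else 1)"
    using cI assms(3) finU
    by (auto simp: card_Diff_singleton_if)
  moreover have "card (A `` {v} \<inter> U) \<le> card J + (if u = a then 0 else 1)"
    using cJ \<open>(v, u) \<notin> A\<close> finU by (auto simp: card_Diff_singleton_if)
  ultimately have big: "m \<le> card I + card J"
    using deg cardU not_both by (auto split: if_splits)
  \<comment> \<open>Position $j$ itself can serve neither $u$ nor $v$, so $I$ and $J$ share a position by pigeonhole.\<close>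
  have jm: "?j < m" by (simp add: m_def)
  have "I \<union> J \<subseteq> {..<m} - {?j}"
    using assms(2) by (auto simp: I_def J_def nth_append irrefl_def)
  then have "card (I \<union> J) \<le> m - 1"
    using card_mono[of "{..<m} - {?j}" "I \<union> J"] jm by simp
  moreover have "finite I" "finite J" by (auto simp: I_def J_def)
  ultimately have "I \<inter> J \<noteq> {}"
    using big jm card_Un_disjoint[of I J] by auto
  then obtain i where i: "i < m" "(u, ?p ! i) \<in> A" "(v, ?p ! Suc i) \<in> A"
    by (auto simp: I_def J_def)
  have ij: "i \<noteq> ?j" using i(2) assms(2) by (auto simp: irrefl_def)
  show ?thesis
  proof (cases "i < ?j")
    case True
    define \<alpha> where "\<alpha> = take (Suc i) (xs @ [u])"
    define \<beta> where "\<beta> = drop (Suc i) (xs @ [u])"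
    have ab: "xs @ [u] = \<alpha> @ \<beta>"
      unfolding \<alpha>_def \<beta>_def by (rule append_take_drop_id[symmetric])
    have ne: "\<alpha> \<noteq> []" "\<beta> \<noteq> []" using True by (auto simp: \<alpha>_def \<beta>_def)
    have la: "last \<alpha> = ?p ! i"
      using True by (simp add: \<alpha>_def take_Suc_conv_app_nth nth_append)
    have hb: "hd \<beta> = ?p ! Suc i"
      using True by (auto simp: \<beta>_def hd_drop_conv_nth nth_append less_Suc_eq)
    have lb: "last \<beta> = u" using ab ne by (metis last_append last_snoc)
    let ?q = "\<alpha> @ rev \<beta> @ v # ys"
    have pq: "?p = \<alpha> @ \<beta> @ v # ys" using ab by (metis append.assoc append_Cons append_Nil)
    have "successively (\<lambda>u v. (u, v) \<in> A) \<alpha>" "successively (\<lambda>u v. (v, u) \<in> A) \<beta>"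
      using left assms(1) unfolding ab
      by (auto simp: successively_append_iff elim!: successively_mono dest: symD)
    then have "successively (\<lambda>u v. (u, v) \<in> A) ?q"
      using right i(2,3) ne assms(1)
      by (auto simp: successively_append_iff hd_append hd_rev last_rev la hb lb dest: symD)
    moreover have "distinct ?q" "set ?q = U" using p unfolding pq by auto
    moreover have "hd ?q = a" "last ?q = b" using ends ne unfolding pq by (auto simp: hd_append)
    ultimately show ?thesis unfolding hamiltonian_path_def by (intro exI[of _ ?q]) auto
  next
    case False
    define d where "d = i - ?j"
    have d: "i = ?j + d" "d > 0" "d < length (v # ys)"
      using False ij i(1) by (auto simp: d_def m_def)
    define \<gamma> where "\<gamma> = take d (v # ys)"
    define \<delta> where "\<delta> = drop d (v # ys)"
    have cd: "v # ys = \<gamma> @ \<delta>" by (simp add: \<gamma>_def \<delta>_def)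
    have ne: "\<gamma> \<noteq> []" "\<delta> \<noteq> []" using d by (auto simp: \<gamma>_def \<delta>_def)
    obtain e where e: "d = Suc e" using d(2) by (cases d) auto
    have "length \<gamma> = Suc e" using d e by (simp add: \<gamma>_def)
    then have "last \<gamma> = \<gamma> ! e" using ne(1) by (simp add: last_conv_nth)
    also have "\<dots> = (v # ys) ! e" unfolding \<gamma>_def e by (rule nth_take) simp
    also have "\<dots> = ?p ! i" using d e by (simp add: nth_append)
    finally have lg: "last \<gamma> = ?p ! i" .
    have hd': "hd \<delta> = ?p ! Suc i"
      using d e by (simp add: \<delta>_def hd_drop_conv_nth nth_append)
    have hg: "hd \<gamma> = v" using cd ne by (metis hd_append2 list.sel(1))
    let ?q = "xs @ u # rev \<gamma> @ \<delta>"
    have pq: "?p = xs @ u # \<gamma> @ \<delta>" using cd by simp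
    have "successively (\<lambda>u v. (v, u) \<in> A) \<gamma>" "successively (\<lambda>u v. (u, v) \<in> A) \<delta>"
      using right assms(1) unfolding cd
      by (auto simp: successively_append_iff elim!: successively_mono dest: symD)
    then have "successively (\<lambda>u v. (u, v) \<in> A) ((xs @ [u]) @ rev \<gamma> @ \<delta>)"
      using left i(2,3) ne
      by (auto simp: successively_append_iff successively_Cons hd_append hd_rev last_rev lg hd' hg)
    then have "successively (\<lambda>u v. (u, v) \<in> A) ?q" by simp
    moreover have "distinct ?q" "set ?q = U" using p unfolding pq by auto
    moreover have "hd ?q = a" "last ?q = b" using ends ne unfolding pq by (auto simp: hd_append)
    ultimately show ?thesis unfolding hamiltonian_path_def by (intro exI[of _ ?q]) auto
  qed
qed

text \<open>
  The pair $\{a, b\}$ is free of any degree condition: an edge joining the two ends lies on no Hamiltonian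
  path between them once there is a third vertex.
\<close>

lemma crossing:
  assumes "sym A" "irrefl A" "(u, v) \<notin> A" "u \<noteq> v"
    and path: "hamiltonian_path (A \<union> {(u, v), (v, u)}) U a b"
    and deg: "{u, v} \<noteq> {a, b} \<Longrightarrow> card U + 1 \<le> card (A `` {u} \<inter> U) + card (A `` {v} \<inter> U)
                + (if {u, v} \<inter> {a, b} \<noteq> {} then 1 else 0)"
    and three: "{u, v} = {a, b} \<Longrightarrow> 3 \<le> card U"
  shows "hamiltonian_path A U a b"
proof -
  let ?B = "A \<union> {(u, v), (v, u)}"
  obtain p where p: "distinct p" "p \<noteq> []" "set p = U" "hd p = a" "last p = b"
      "successively (\<lambda>u v. (u, v) \<in> ?B) p"
    using path unfolding hamiltonian_path_def by blast
  show ?thesis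
  proof (cases "successively (\<lambda>u v. (u, v) \<in> A) p")
    case True
    then show ?thesis using p unfolding hamiltonian_path_def by blast
  next
    case False
    then obtain j where j: "Suc j < length p" "(p ! j, p ! Suc j) \<notin> A"
      unfolding successively_conv_nth by blast
    then have "(p ! j, p ! Suc j) \<in> ?B" using p(6) successively_nth by fastforce
    then obtain x y where xy: "x = p ! j" "y = p ! Suc j" "x = u \<and> y = v \<or> x = v \<and> y = u"
      using j by auto
    define xs where "xs = take j p"
    define ys where "ys = drop (Suc (Suc j)) p"
    have p_eq: "p = xs @ x # y # ys"
      using j xy by (simp add: xs_def ys_def Cons_nth_drop_Suc)
    have notin: "u \<notin> set xs" "v \<notin> set xs" "u \<notin> set ys" "v \<notin> set ys"
      using p(1) xy(3) unfolding p_eq by auto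
    have left: "successively (\<lambda>u v. (u, v) \<in> A) (xs @ [x])"
    proof -
      have "successively (\<lambda>u v. (u, v) \<in> ?B) (xs @ [x])"
        using p(6) unfolding p_eq by (auto simp: successively_append_iff)
      then show ?thesis
        by (rule successively_mono) (use notin xy(3) assms(4) p(1) in \<open>auto simp: p_eq\<close>)
    qed
    have right: "successively (\<lambda>u v. (u, v) \<in> A) (y # ys)"
    proof -
      have "successively (\<lambda>u v. (u, v) \<in> ?B) (y # ys)"
        using p(6) unfolding p_eq by (auto simp: successively_append_iff)
      then show ?thesis
        by (rule successively_mono) (use notin xy(3) assms(4) p(1) in \<open>auto simp: p_eq\<close>)
    qed
    have "a = hd (xs @ [x])" "b = last (y # ys)" using p(4,5) unfolding p_eq by (auto simp: hd_append)
    then have in_parts: "a \<in> set (xs @ [x])" "b \<in> set (y # ys)"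
      by (metis hd_in_set snoc_eq_iff_butlast, metis last_in_set list.distinct(1))
    have xa: "x = a \<longleftrightarrow> xs = []"
      using p(1) \<open>a = hd (xs @ [x])\<close> unfolding p_eq by (cases xs) auto
    have yb: "y = b \<longleftrightarrow> ys = []"
      using p(1) \<open>b = last (y # ys)\<close> last_in_set[of ys] unfolding p_eq by (cases "ys = []") auto
    have xb: "x \<noteq> b" and ya: "y \<noteq> a"
      using in_parts p(1) unfolding p_eq by auto
    have not_both: "\<not> (x = a \<and> y = b)"
    proof
      assume *: "x = a \<and> y = b"
      then have "card U = 2" using distinct_card[OF p(1)] p(3) xa yb unfolding p_eq by simp
      moreover have "{u, v} = {a, b}" using * xy(3) by auto
      ultimately show False using three by simp
    qed
    then have ne: "{u, v} \<noteq> {a, b}"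
      using xy(3) xb ya by (auto simp: doubleton_eq_iff)
    have "(x, y) \<notin> A" using assms(1,3) xy(3) by (auto dest: symD)
    moreover have "card U + 1 \<le> card (A `` {x} \<inter> U) + card (A `` {y} \<inter> U)
                + (if x = a \<or> y = b then 1 else 0)"
      using deg[OF ne] xy(3) xb ya by (auto split: if_splits)
    ultimately show ?thesis
      using crossing_oriented[OF assms(1,2), of x y xs ys U a b] p left right not_both
      unfolding p_eq by blast
  qed
qed

section \<open>Codegrees in graphs without a Hamiltonian path\<close>

definition non_nbrs :: "'a rel \<Rightarrow> 'a set \<Rightarrow> 'a \<Rightarrow> 'a set" where
  "non_nbrs A U v = {w \<in> U. w \<noteq> v \<and> (v, w) \<notin> A}"

lemma card_non_nbrs:
  assumes "finite U" "irrefl A" "v \<in> U"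
  shows "card (A `` {v} \<inter> U) + card (non_nbrs A U v) + 1 = card U"
proof -
  have "U = insert v ((A `` {v} \<inter> U) \<union> non_nbrs A U v)"
    using assms(3) by (auto simp: non_nbrs_def)
  moreover have "v \<notin> (A `` {v} \<inter> U) \<union> non_nbrs A U v"
    using assms(2) by (auto simp: non_nbrs_def irrefl_def)
  moreover have "(A `` {v} \<inter> U) \<inter> non_nbrs A U v = {}" by (auto simp: non_nbrs_def)
  moreover have "finite (A `` {v} \<inter> U)" "finite (non_nbrs A U v)"
    using assms(1) by (auto simp: non_nbrs_def)
  ultimately show ?thesis
    by (metis Suc_eq_plus1 card_Un_disjoint card_insert_disjoint finite_UnI)
qed

lemma non_nbrs_antimono: "A \<subseteq> B \<Longrightarrow> U \<subseteq> V \<Longrightarrow> non_nbrs B U v \<subseteq> non_nbrs A V v"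
  by (auto simp: non_nbrs_def)

lemma maximal_non_hamiltonian:
  assumes "finite U" "sym A" "irrefl A" "\<not> hamiltonian_path A U a b"
  obtains F where "A \<inter> U \<times> U \<subseteq> F" "sym F" "irrefl F" "\<not> hamiltonian_path F U a b"
    "\<And>u v. u \<in> U \<Longrightarrow> v \<in> U \<Longrightarrow> u \<noteq> v \<Longrightarrow> (u, v) \<notin> F \<Longrightarrow>
        hamiltonian_path (F \<union> {(u, v), (v, u)}) U a b"
proof -
  define \<F> where "\<F> = {F. F \<subseteq> U \<times> U \<and> sym F \<and> irrefl F \<and> \<not> hamiltonian_path F U a b}"
  have "finite \<F>"
    by (rule finite_subset[of _ "Pow (U \<times> U)"]) (use assms(1) in \<open>auto simp: \<F>_def\<close>)
  moreover have "A \<inter> U \<times> U \<in> \<F>"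
  proof -
    have "hamiltonian_path A U a b" if "hamiltonian_path (A \<inter> U \<times> U) U a b"
      using that unfolding hamiltonian_path_def by (auto elim!: successively_mono)
    then show ?thesis
      using assms by (auto simp: \<F>_def sym_def irrefl_def)
  qed
  ultimately obtain F where F: "F \<in> \<F>" "A \<inter> U \<times> U \<subseteq> F" "\<And>F'. F' \<in> \<F> \<Longrightarrow> F \<subseteq> F' \<Longrightarrow> F = F'"
    using finite_has_maximal2[of \<F> "A \<inter> U \<times> U"] by metis
  show thesis
  proof (rule that[of F])
    fix u v assume uv: "u \<in> U" "v \<in> U" "u \<noteq> v" "(u, v) \<notin> F"
    have "F \<union> {(u, v), (v, u)} \<notin> \<F>"
      using F(3)[of "F \<union> {(u, v), (v, u)}"] uv(4) by blast
    moreover have "F \<union> {(u, v), (v, u)} \<subseteq> U \<times> U" "sym (F \<union> {(u, v), (v, u)})"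
      "irrefl (F \<union> {(u, v), (v, u)})"
      using F(1) uv by (auto simp: \<F>_def sym_def irrefl_def)
    ultimately show "hamiltonian_path (F \<union> {(u, v), (v, u)}) U a b"
      by (auto simp: \<F>_def)
  qed (use F in \<open>auto simp: \<F>_def\<close>)
qed

text \<open>
  This is the degree-sequence argument of Chvatal for Hamiltonian paths with prescribed ends, told in the
  complement. In a maximal graph without such a path take a nonadjacent pair $u$, $v$ whose codegree sum is
  least, with codegrees $p \<ge> q$. By minimality every non-neighbour of $v$ has codegree at least $p$ and every
  non-neighbour of $u$ codegree at least $q$; this gives $Q$ and, together with $u$ itself, $P$.
  Maximality and \<open>crossing\<close> bound $p + q$ from below. Passing back to the smaller graph
  only increases codegrees.
\<close>

lemma non_hamiltonian_codegrees:
  assumes fin: "finite U" and "sym A" "irrefl A" "a \<in> U" "b \<in> U" "a \<noteq> b" "3 \<le> card U"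
    and no_path: "\<not> hamiltonian_path A U a b"
  obtains p q u P Q where "q \<le> p" "card U \<le> p + q + 2"
    "u \<in> U" "p \<le> card (non_nbrs A U u)"
    "P \<subseteq> U" "p + 1 \<le> card P" "\<And>z. z \<in> P \<Longrightarrow> q \<le> card (non_nbrs A U z)"
    "Q \<subseteq> U" "q \<le> card Q" "\<And>z. z \<in> Q \<Longrightarrow> p \<le> card (non_nbrs A U z)"
proof -
  obtain F where F: "A \<inter> U \<times> U \<subseteq> F" "sym F" "irrefl F" "\<not> hamiltonian_path F U a b"
    and max: "\<And>u v. u \<in> U \<Longrightarrow> v \<in> U \<Longrightarrow> u \<noteq> v \<Longrightarrow> (u, v) \<notin> F \<Longrightarrow>
        hamiltonian_path (F \<union> {(u, v), (v, u)}) U a b"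
    using maximal_non_hamiltonian[OF fin assms(2,3) no_path] by blast
  define c where "c z = card (non_nbrs F U z)" for z
  have c_le: "c z \<le> card (non_nbrs A U z)" if "z \<in> U" for z
    unfolding c_def using F(1) fin that by (intro card_mono) (auto simp: non_nbrs_def)
  define E where "E = {(u, v). u \<in> U \<and> v \<in> U \<and> u \<noteq> v \<and> (u, v) \<notin> F}"
  have "E \<noteq> {}"
    using hamiltonian_path_complete[OF fin assms(4-6), of F] F(4) by (auto simp: E_def)
  moreover have symE: "(v, u) \<in> E" if "(u, v) \<in> E" for u v
    using that F(2) by (auto simp: E_def dest: symD)
  ultimately obtain u v where uv: "(u, v) \<in> E"
    and min: "\<And>x y. (x, y) \<in> E \<Longrightarrow> c u + c v \<le> c x + c y" and vu: "c v \<le> c u"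
  proof -
    obtain e where e: "e \<in> E" "\<And>e'. e' \<in> E \<Longrightarrow> c (fst e) + c (snd e) \<le> c (fst e') + c (snd e')"
      using ex_has_least_nat[of "\<lambda>e. e \<in> E" _ "\<lambda>e. c (fst e) + c (snd e)"] \<open>E \<noteq> {}\<close> by blast
    obtain u v where uv: "e = (u, v)" by (cases e)
    show ?thesis
    proof (cases "c v \<le> c u")
      case True
      then show ?thesis using that[of u v] e uv by fastforce
    next
      case False
      then show ?thesis using that[of v u] e uv symE by (fastforce simp: add.commute)
    qed
  qed
  have uvU: "u \<in> U" "v \<in> U" "u \<noteq> v" "(u, v) \<notin> F" using uv by (auto simp: E_def)
  have sum: "card U \<le> c u + c v + 2"
  proof (rule ccontr)
    assume *: "\<not> card U \<le> c u + c v + 2"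
    have "card U + 1 \<le> card (F `` {u} \<inter> U) + card (F `` {v} \<inter> U)"
      using card_non_nbrs[OF fin F(3) uvU(1)] card_non_nbrs[OF fin F(3) uvU(2)] *
      unfolding c_def by linarith
    then have "hamiltonian_path F U a b"
      using assms(7) by (intro crossing[OF F(2,3) uvU(4,3) max[OF uvU]]) auto
    then show False using F(4) by simp
  qed
  show thesis
  proof (rule that[of "c v" "c u" u "insert u (non_nbrs F U u)" "non_nbrs F U v"])
    show "c u + 1 \<le> card (insert u (non_nbrs F U u))"
      using fin by (simp add: c_def non_nbrs_def)
    fix z
    show "c v \<le> card (non_nbrs A U z)" if "z \<in> insert u (non_nbrs F U u)"
    proof -
      have "c v \<le> c z"
        using that vu min[of u z] uvU by (auto simp: non_nbrs_def E_def)
      then show ?thesis using c_le[of z] that uvU by (auto simp: non_nbrs_def)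
    qed
    show "c u \<le> card (non_nbrs A U z)" if "z \<in> non_nbrs F U v"
    proof -
      have "c u \<le> c z"
        using that min[of v z] uvU by (auto simp: non_nbrs_def E_def)
      then show ?thesis using c_le[of z] that by (auto simp: non_nbrs_def)
    qed
  qed (use vu sum uvU c_le[OF uvU(1)] in \<open>auto simp: c_def non_nbrs_def\<close>)
qed

section \<open>Trees grown leaf by leaf\<close>

lemma degree_eq_card: "degree T v = card (parcs T `` {v})"
proof -
  have "out_arcs (with_proj T) v = Pair v ` (parcs T `` {v})" by (auto simp: out_arcs_def)
  then show ?thesis by (simp add: out_degree_def card_image inj_on_def)
qed

lemma connected_iff_rtrancl:
  assumes "pair_graph T"
  shows "connected (with_proj T) \<longleftrightarrow>
    pverts T \<noteq> {} \<and> (\<forall>u\<in>pverts T. \<forall>v\<in>pverts T. (u, v) \<in> (parcs T)\<^sup>*)"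
proof -
  interpret pair_graph T by fact
  have sym: "symmetric (with_proj T)" by (rule sym_arcs)
  have "u \<rightarrow>\<^sup>*\<^bsub>mk_symmetric (with_proj T)\<^esub> v \<longleftrightarrow> (u, v) \<in> (parcs T)\<^sup>*" if "u \<in> pverts T" for u v
    unfolding reachable_mk_symmetric_eq[OF sym] using reachable_conv'[OF that] by simp
  moreover have "pverts (mk_symmetric (with_proj T)) = pverts T" by (simp add: mk_symmetric_def)
  ultimately show ?thesis unfolding connected_def strongly_connected_def by simp
qed

lemma pcas_append: "pcas u (p @ q) v \<longleftrightarrow> (\<exists>w. pcas u p w \<and> pcas w q v)"
  by (induction p arbitrary: u) auto

lemma pcas_rotate: "pcas u (as @ (v, w) # bs) u \<Longrightarrow> pcas w (bs @ as) v"
  by (auto simp: pcas_append)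

lemma map_snd_cycle: "pcas u p v \<Longrightarrow> tl (pawalk_verts u p) = map snd p"
proof -
  have "pawalk_verts w q = w # map snd q" if "pcas w q v" for w q
    using that by (induction q arbitrary: w) auto
  then show "pcas u p v \<Longrightarrow> tl (pawalk_verts u p) = map snd p" by simp
qed

lemma cycle_iff:
  "pre_digraph.cycle (with_proj T) p \<longleftrightarrow>
    (\<exists>u. u \<in> pverts T \<and> set p \<subseteq> parcs T \<and> pcas u p u \<and> distinct (map snd p) \<and> p \<noteq> [])"
  unfolding pre_digraph.cycle_def pre_digraph.awalk_def
  by (auto simp: cas_with_proj_eq awalk_verts_with_proj_eq map_snd_cycle)

lemma pcas_fst_hd: "pcas u p v \<Longrightarrow> p \<noteq> [] \<Longrightarrow> fst (hd p) = u"
  by (cases p) auto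

lemma pcas_snd_last: "pcas u p v \<Longrightarrow> p \<noteq> [] \<Longrightarrow> snd (last p) = v"
  by (induction p arbitrary: u) auto

text \<open>
  A new cycle of length at least 3 would use both arcs at the new vertex $y$, entering it from $x$ and leaving
  it to $x$. Removing the arc $(x, y)$ from the closed walk leaves a walk of at least two arcs that starts with
  $(y, x)$ and ends in $x$, so $x$ is the head of two of its arcs, whereas the heads of the arcs of a cycle are distinct.
\<close>

lemma undirected_tree_add_leaf:
  assumes T: "undirected_tree T" and x: "x \<in> pverts T" and y: "y \<notin> pverts T"
  shows "undirected_tree \<lparr>pverts = insert y (pverts T), parcs = parcs T \<union> {(x, y), (y, x)}\<rparr>"
    (is "undirected_tree ?T'")
proof -
  have pg: "pair_graph T" using T by (simp add: undirected_tree_def)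
  then interpret pair_graph T .
  have xy: "x \<noteq> y" using x y by auto
  have pg': "pair_graph ?T'"
  proof -
    have "sym (parcs ?T')"
      by (rule symI) (auto dest: arcs_symmetric)
    then show ?thesis
      using x xy pair_finite_verts pair_finite_arcs
      by unfold_locales
        (auto simp: symmetric_def dest: in_arcsD1 in_arcsD2 pair_no_loops)
  qed
  have reach: "\<And>u v. u \<in> pverts T \<Longrightarrow> v \<in> pverts T \<Longrightarrow> (u, v) \<in> (parcs T)\<^sup>*"
    using T connected_iff_rtrancl[OF pg] by (auto simp: undirected_tree_def)
  have mono: "(u, v) \<in> (parcs T)\<^sup>* \<Longrightarrow> (u, v) \<in> (parcs ?T')\<^sup>*" for u v
    by (rule rtrancl_mono[THEN subsetD, rotated]) auto
  have x_reach: "(x, v) \<in> (parcs ?T')\<^sup>*" "(v, x) \<in> (parcs ?T')\<^sup>*" if "v \<in> pverts ?T'" for v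
    using that reach[OF x, of v] reach[OF _ x, of v] mono by auto
  have "connected (with_proj ?T')"
    unfolding connected_iff_rtrancl[OF pg']
    using rtrancl_trans[OF x_reach(2) x_reach(1)] by auto
  moreover have "length p < 3" if cyc: "pre_digraph.cycle (with_proj ?T') p" for p
  proof (rule ccontr)
    assume "\<not> length p < 3"
    obtain u where u: "u \<in> pverts ?T'" "set p \<subseteq> parcs ?T'" "pcas u p u" "distinct (map snd p)" "p \<noteq> []"
      using cyc unfolding cycle_iff by blast
    have at_y: "e = (x, y)" if "e \<in> set p" "snd e = y" for e
    proof -
      have "e \<in> parcs T \<union> {(x, y), (y, x)}" using that(1) u(2) by auto
      then show ?thesis using that(2) y xy arc_snd_in_verts[of e] by (cases e) auto
    qed
    have from_y: "e = (y, x)" if "e \<in> set p" "fst e = y" for e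
    proof -
      have "e \<in> parcs T \<union> {(x, y), (y, x)}" using that(1) u(2) by auto
      then show ?thesis using that(2) y xy arc_fst_in_verts[of e] by (cases e) auto
    qed
    have closed: "pcas w (bs @ as) v \<and> bs @ as \<noteq> [] \<and> length (bs @ as) \<ge> 2 \<and>
        set (bs @ as) \<subseteq> set p \<and> distinct (map snd (bs @ as))"
      if "p = as @ (v, w) # bs" for as bs v w
      using pcas_rotate[of u as v w bs] that u(3,4) \<open>\<not> length p < 3\<close> by auto
    have not_xy: "(x, y) \<notin> set p"
    proof
      assume "(x, y) \<in> set p"
      then obtain as bs where "p = as @ (x, y) # bs" by (meson split_list)
      note c = closed[OF this]
      let ?c = "bs @ as"
      have "hd ?c = (y, x)"
        using c pcas_fst_hd[of y ?c x] from_y hd_in_set[of ?c] by (metis subsetD)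
      then have "snd (hd ?c) = snd (last ?c)"
        using c pcas_snd_last[of y ?c x] by simp
      then have "map snd ?c ! 0 = map snd ?c ! (length ?c - 1)"
        using c by (simp add: hd_conv_nth last_conv_nth del: length_append map_append)
      then show False
        using c nth_eq_iff_index_eq[of "map snd ?c" 0 "length ?c - 1"]
        by (simp del: length_append map_append)
    qed
    have "(y, x) \<notin> set p"
    proof
      assume "(y, x) \<in> set p"
      then obtain as bs where "p = as @ (y, x) # bs" by (meson split_list)
      note c = closed[OF this]
      have "last (bs @ as) = (x, y)"
        using c pcas_snd_last[of x "bs @ as" y] at_y last_in_set[of "bs @ as"] by (metis subsetD)
      then show False using c not_xy last_in_set[of "bs @ as"] by (metis subsetD)
    qed
    then have "set p \<subseteq> parcs T" using u(2) not_xy by auto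
    moreover then have "u \<in> pverts T"
      using pcas_fst_hd[OF u(3,5)] hd_in_set[OF u(5)] by (metis arc_fst_in_verts subsetD)
    ultimately have "pre_digraph.cycle (with_proj T) p" using u unfolding cycle_iff by blast
    then show False using T \<open>\<not> length p < 3\<close> by (auto simp: undirected_tree_def)
  qed
  ultimately show ?thesis using pg' by (auto simp: undirected_tree_def not_le)
qed

lemma undirected_tree_single: "undirected_tree \<lparr>pverts = {x}, parcs = {}\<rparr>"
proof -
  have pg: "pair_graph \<lparr>pverts = {x}, parcs = {}\<rparr>"
    by unfold_locales (auto simp: symmetric_def sym_def)
  show ?thesis
    unfolding undirected_tree_def connected_iff_rtrancl[OF pg] using pg by (auto simp: cycle_iff)
qed

text \<open>
  All spanning trees below are grown by hanging new leaves onto old vertices, so it is enough to keep track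
  of the vertex set and of the leaf set.
\<close>

definition tree_with_leaves :: "'a rel \<Rightarrow> 'a set \<Rightarrow> 'a set \<Rightarrow> bool" where
  "tree_with_leaves A U L \<longleftrightarrow>
     (\<exists>T. undirected_tree T \<and> pverts T = U \<and> parcs T \<subseteq> A \<and> leaves T = L)"

lemma tree_with_leaves_edge:
  assumes "(x, y) \<in> A" "(y, x) \<in> A" "x \<noteq> y"
  shows "tree_with_leaves A {x, y} {x, y}"
proof -
  let ?T = "\<lparr>pverts = {y, x}, parcs = {(x, y), (y, x)}\<rparr>"
  have "undirected_tree ?T"
    using undirected_tree_add_leaf[OF undirected_tree_single[of x], of x y] assms(3) by simp
  moreover have "leaves ?T = {x, y}"
  proof -
    have "parcs ?T `` {x} = {y}" "parcs ?T `` {y} = {x}" using assms(3) by auto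
    then show ?thesis by (auto simp: leaves_def degree_eq_card)
  qed
  ultimately show ?thesis
    unfolding tree_with_leaves_def using assms by (intro exI[of _ ?T]) auto
qed

text \<open>
  Since $U \<noteq> \{x\}$, the vertex $x$ already has a neighbour in the tree and so is no leaf afterwards.
\<close>

lemma tree_with_leaves_pendant:
  assumes tree: "tree_with_leaves A U L" and U: "x \<in> U" "U \<noteq> {x}" "y \<notin> U"
    and edge: "(x, y) \<in> A" "(y, x) \<in> A"
  shows "tree_with_leaves A (insert y U) (insert y (L - {x}))"
proof -
  obtain T where T: "undirected_tree T" "pverts T = U" "parcs T \<subseteq> A" "leaves T = L"
    using tree unfolding tree_with_leaves_def by blast
  have pg: "pair_graph T" using T by (simp add: undirected_tree_def)
  then interpret pair_graph T .
  let ?T' = "\<lparr>pverts = insert y (pverts T), parcs = parcs T \<union> {(x, y), (y, x)}\<rparr>"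
  have xy: "x \<noteq> y" using U by auto
  obtain z where "z \<in> U" "z \<noteq> x" using U by auto
  then have "(x, z) \<in> (parcs T)\<^sup>*"
    using T(1,2) U(1) connected_iff_rtrancl[OF pg] by (auto simp: undirected_tree_def)
  then obtain w where w: "(x, w) \<in> parcs T"
    using \<open>z \<noteq> x\<close> by (metis converse_rtranclE)
  have noy: "(y, v) \<notin> parcs T" "(v, y) \<notin> parcs T" for v
    using U(3) T(2) in_arcsD1 in_arcsD2 by blast+
  have fin: "finite (parcs T `` {v})" for v
    by (rule finite_subset[of _ "pverts T"]) (use in_arcsD2 pair_finite_verts in auto)
  have y_leaf: "degree ?T' y = 1"
  proof -
    have "parcs ?T' `` {y} = {x}" using noy xy by auto
    then show ?thesis by (simp add: degree_eq_card)
  qed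
  have x_inner: "degree ?T' x \<noteq> 1"
  proof -
    have "parcs ?T' `` {x} = insert y (parcs T `` {x})" using xy by auto
    moreover have "card (parcs T `` {x}) > 0" using w fin card_gt_0_iff by blast
    moreover have "y \<notin> parcs T `` {x}" using noy by auto
    ultimately have "degree ?T' x = Suc (card (parcs T `` {x}))"
      unfolding degree_eq_card using fin by simp
    then show ?thesis using \<open>card (parcs T `` {x}) > 0\<close> by linarith
  qed
  have other: "degree ?T' v = degree T v" if "v \<noteq> x" "v \<noteq> y" for v
  proof -
    have "parcs ?T' `` {v} = parcs T `` {v}" using that by auto
    then show ?thesis by (simp add: degree_eq_card)
  qed
  have "leaves ?T' = insert y (leaves T - {x})"
  proof (rule set_eqI)
    fix v
    consider "v = x" | "v = y" | "v \<noteq> x" "v \<noteq> y" by blast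
    then show "v \<in> leaves ?T' \<longleftrightarrow> v \<in> insert y (leaves T - {x})"
      using x_inner y_leaf other[of v] xy by cases (auto simp: leaves_def)
  qed
  then show ?thesis
    unfolding tree_with_leaves_def
    using undirected_tree_add_leaf[OF T(1)] T U edge by (intro exI[of _ ?T']) auto
qed

lemma tree_with_leaves_path:
  assumes "sym A" "hamiltonian_path A U a b" "a \<noteq> b"
  shows "tree_with_leaves A U {a, b}"
proof -
  obtain p where p: "distinct p" "p \<noteq> []" "set p = U" "hd p = a" "last p = b"
      "successively (\<lambda>u v. (u, v) \<in> A) p"
    using assms(2) unfolding hamiltonian_path_def by blast
  have "tree_with_leaves A (set q) {hd q, last q}"
    if "distinct q" "2 \<le> length q" "successively (\<lambda>u v. (u, v) \<in> A) q" for q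
    using that
  proof (induction q rule: rev_induct)
    case (snoc y q)
    have edge: "(last q, y) \<in> A" "(y, last q) \<in> A"
      using snoc.prems assms(1) by (auto simp: successively_append_iff Suc_le_eq dest: symD)
    have lq: "last q \<in> set q" "q \<noteq> []" "last q \<noteq> y"
      using snoc.prems last_in_set[of q] by (auto simp: Suc_le_eq)
    show ?case
    proof (cases "length q = 1")
      case True
      then obtain x where "q = [x]" by (auto simp: length_Suc_conv)
      then show ?thesis using tree_with_leaves_edge[of x y A] edge lq by auto
    next
      case False
      then have two: "2 \<le> length q" using lq(2) by (cases q) (auto simp: Suc_le_eq)
      have hl: "hd q \<noteq> last q"
        using two snoc.prems(1) by (cases q) (auto split: if_splits)
      have IH: "tree_with_leaves A (set q) {hd q, last q}"
        using snoc two by (simp add: successively_append_iff)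
      have "set q \<noteq> {last q}" using hl hd_in_set[OF lq(2)] by blast
      moreover have "y \<notin> set q" using snoc.prems(1) by simp
      ultimately have "tree_with_leaves A (insert y (set q)) (insert y ({hd q, last q} - {last q}))"
        using tree_with_leaves_pendant[OF IH lq(1) _ _ edge] by blast
      moreover have "insert y ({hd q, last q} - {last q}) = {hd (q @ [y]), last (q @ [y])}"
        using hl lq(2) by auto
      ultimately show ?thesis by simp
    qed
  qed simp
  moreover have "2 \<le> length p"
    using p(2,4,5) assms(3) by (cases p; cases "tl p") (auto simp: Suc_le_eq)
  ultimately show ?thesis using p by blast
qed

lemma tree_with_leaves_attach:
  assumes tree: "tree_with_leaves A U L" and "sym A" "finite R" "R \<inter> U = {}" "L \<noteq> {}" 
    and nbr: "\<And>s. s \<in> R \<Longrightarrow> \<exists>x\<in>U - L. (s, x) \<in> A" and "L \<subseteq> U"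
  shows "tree_with_leaves A (U \<union> R) (L \<union> R)"
  using assms(3,4) nbr
proof (induction R rule: finite_induct)
  case empty
  then show ?case using tree by simp
next
  case (insert s R)
  obtain x where x: "x \<in> U - L" "(s, x) \<in> A" using insert.prems by blast
  have "x \<notin> R" using x insert.prems(1) by auto
  have IH: "tree_with_leaves A (U \<union> R) (L \<union> R)"
    using insert.IH insert.prems by simp
  have "U \<union> R \<noteq> {x}" using x(1) assms(5,7) by auto
  moreover have "s \<notin> U \<union> R" "x \<in> U \<union> R" using x insert.hyps(2) insert.prems(1) by auto
  moreover have "(x, s) \<in> A" using x(2) assms(2) by (meson symD)
  ultimately have "tree_with_leaves A (insert s (U \<union> R)) (insert s (L \<union> R - {x}))"
    using tree_with_leaves_pendant[OF IH _ _ _ _ x(2)] by blast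
  moreover have "insert s (L \<union> R - {x}) = L \<union> insert s R" using x \<open>x \<notin> R\<close> by auto
  ultimately show ?case by simp
qed

section \<open>Hamiltonian paths and the closure\<close>

lemma pair_graph_sym_irrefl:
  assumes "pair_graph G"
  shows "sym (parcs G)" "irrefl (parcs G)"
proof -
  interpret pair_graph G by fact
  show "sym (parcs G)" by (rule symI) (rule arcs_symmetric)
  show "irrefl (parcs G)" by (auto simp: irrefl_def dest: pair_no_loops)
qed

text \<open>
  Going back through the closure one edge at a time, \<open>crossing\<close> applies inside $U$. In an
  intermediate graph the degree of $u$ within $U$ falls short of its full degree by at most the number of
  its neighbours outside $U$ in the final graph $H$, whose arcs contain those of every intermediate graph.
\<close>

lemma hamiltonian_path_of_closure:
  assumes steps: "(closure_step l)\<^sup>*\<^sup>* G H" and "pair_graph G" "U \<subseteq> pverts G" "3 \<le> card U"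
    and path: "hamiltonian_path (parcs H) U a b"
    and loss: "\<And>u v. u \<in> U \<Longrightarrow> v \<in> U \<Longrightarrow> u \<noteq> v \<Longrightarrow> {u, v} \<noteq> {a, b} \<Longrightarrow>
      card U + 1 + card (parcs H `` {u} - U) + card (parcs H `` {v} - U)
        \<le> l + (if {u, v} \<inter> {a, b} \<noteq> {} then 1 else 0)"
  shows "hamiltonian_path (parcs G) U a b"
proof -
  have finH: "finite (parcs H `` {u})" for u
  proof -
    interpret H: pair_graph H using closure_steps_pair_graph[OF steps assms(2)] by simp
    show ?thesis by (rule finite_subset[of _ "pverts H"]) (use H.in_arcsD2 H.pair_finite_verts in auto)
  qed
  show ?thesis using steps assms(2,3)
  proof (induction rule: converse_rtranclp_induct)
    case base
    show ?case by (rule path)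
  next
    case (step G G')
    have "pair_graph G'" "pverts G' = pverts G"
      using closure_steps_pair_graph[of l G G'] step.hyps(1) step.prems(1) by auto
    then have IH: "hamiltonian_path (parcs G') U a b" using step.IH step.prems(2) by simp
    have sub: "parcs G \<subseteq> parcs H"
      using closure_steps_mono[of l G H] step.hyps by (meson converse_rtranclp_into_rtranclp)
    note si = pair_graph_sym_irrefl[OF step.prems(1)]
    have deg: "degree G u \<le> card (parcs G `` {u} \<inter> U) + card (parcs H `` {u} - U)" for u
    proof -
      have "parcs G `` {u} \<subseteq> (parcs G `` {u} \<inter> U) \<union> (parcs H `` {u} - U)"
        using sub by auto
      moreover have "finite ((parcs G `` {u} \<inter> U) \<union> (parcs H `` {u} - U))"
        using finH[of u] sub by (auto intro: finite_subset[of _ "parcs H `` {u}"])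
      ultimately have "card (parcs G `` {u}) \<le> card ((parcs G `` {u} \<inter> U) \<union> (parcs H `` {u} - U))"
        by (rule card_mono[rotated])
      also have "\<dots> \<le> card (parcs G `` {u} \<inter> U) + card (parcs H `` {u} - U)" by (rule card_Un_le)
      finally show ?thesis by (simp add: degree_eq_card)
    qed
    from step.hyps(1) show ?case
    proof cases
      case (1 u v)
      have arcs: "parcs G' = parcs G \<union> {(u, v), (v, u)}" using 1 by (simp add: add_edge_def)
      show ?thesis
      proof (cases "u \<in> U \<and> v \<in> U")
        case False
        obtain p where p: "distinct p" "p \<noteq> []" "set p = U" "hd p = a" "last p = b"
            "successively (\<lambda>u v. (u, v) \<in> parcs G') p"
          using IH unfolding hamiltonian_path_def by blast
        have "successively (\<lambda>u v. (u, v) \<in> parcs G) p"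
          using p(6) by (rule successively_mono) (use False p(3) arcs in auto)
        then show ?thesis using p unfolding hamiltonian_path_def by blast
      next
        case True
        show ?thesis
        proof (rule crossing[OF si 1(5) 1(4) IH[unfolded arcs]])
          assume "{u, v} \<noteq> {a, b}"
          with loss[of u v] True 1(4)
          have "card U + 1 + card (parcs H `` {u} - U) + card (parcs H `` {v} - U)
              \<le> l + (if {u, v} \<inter> {a, b} \<noteq> {} then 1 else 0)" by blast
          then show "card U + 1 \<le> card (parcs G `` {u} \<inter> U) + card (parcs G `` {v} \<inter> U)
              + (if {u, v} \<inter> {a, b} \<noteq> {} then 1 else 0)"
            using deg[of u] deg[of v] 1(6) by linarith
        qed (use assms(4) in simp)
      qed
    qed
  qed
qed

section \<open>The Zagreb index of the complement\<close>

text \<open>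
  The left side is the contribution of $q$ vertices of codegree $p$ and $p + 1 - q$ further vertices of
  codegree $q$ to the Zagreb index of the complement. For fixed $q \<ge> 3$ it is least at $p = m - q$ or, if
  $2q > m$, at $p = q$. In the first case its least value over $3 \<le> q \<le> m/2$ is $3m^2 - 9m - 18$ at $q = 3$,
  which exceeds $3m^2 - 11m$. In the second it is $q^3 + q^2$ with $q \<ge> 9$ and $m \<le> 2q - 1$, which is also too large.
\<close>

lemma zagreb_bound_int:
  fixes p q m :: int
  assumes m: "17 \<le> m" and "0 \<le> q" "q \<le> p" "m \<le> p + q" "p \<le> m - 2"
    and bound: "q * p\<^sup>2 + (p + 1 - q) * q\<^sup>2 \<le> m * (3 * m - 11)"
  shows "q = 2 \<and> p = m - 2"
proof -
  have "\<not> 3 \<le> q"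
  proof
    assume q3: "3 \<le> q"
    show False
    proof (cases "2 * q \<le> m")
      case True
      have pm: "m - q \<le> p" "0 \<le> m - q" using assms True by linarith+
      have "(m - q)\<^sup>2 \<le> p\<^sup>2" using pm by (intro power_mono) auto
      then have "q * (m - q)\<^sup>2 \<le> q * p\<^sup>2" using assms(2) by (intro mult_left_mono) auto
      moreover have "(m - q + 1 - q) * q\<^sup>2 \<le> (p + 1 - q) * q\<^sup>2"
        using pm by (intro mult_right_mono) auto
      moreover have "q * (m - q)\<^sup>2 + (m - q + 1 - q) * q\<^sup>2 =
          3 * m\<^sup>2 - 9 * m - 18 + (q - 3) * (m\<^sup>2 - (q + 3) * m - q\<^sup>2 - 2 * q - 6)"
        by (simp add: power2_eq_square algebra_simps)
      moreover have "0 \<le> (q - 3) * (m\<^sup>2 - (q + 3) * m - q\<^sup>2 - 2 * q - 6)"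
      \<comment> \<open>The general estimate of the second factor needs $m(m - 16) \<ge> 24$ and just fails at $m = 17$.\<close>
      proof (cases "m = 17")
        case True
        then have "q \<in> {3..8}" using \<open>2 * q \<le> m\<close> q3 by auto
        then have "q \<in> {3, 4, 5, 6, 7, 8}" by auto
        then show ?thesis using True by auto
      next
        case False
        then have m18: "18 \<le> m" using m by simp
        have "2 * q * m \<le> m * m" using \<open>2 * q \<le> m\<close> m by (intro mult_right_mono) auto
        moreover have "(2 * q) * (2 * q) \<le> m * m" using \<open>2 * q \<le> m\<close> q3 by (intro mult_mono) auto
        moreover have "18 * 2 \<le> m * (m - 16)" using m18 by (intro mult_mono) auto
        ultimately have "0 \<le> m\<^sup>2 - (q + 3) * m - q\<^sup>2 - 2 * q - 6"
          using \<open>2 * q \<le> m\<close> by (simp add: power2_eq_square algebra_simps)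
        then show ?thesis using q3 by simp
      qed
      ultimately have "3 * m\<^sup>2 - 9 * m - 18 \<le> m * (3 * m - 11)" using bound by linarith
      then show False using m by (simp add: power2_eq_square algebra_simps)
    next
      case False
      then have mq: "m \<le> 2 * q - 1" and q9: "9 \<le> q" using m by auto
      have "q\<^sup>2 \<le> p\<^sup>2" using assms(2,3) by (intro power_mono) auto
      then have "q * q\<^sup>2 \<le> q * p\<^sup>2" using assms(2) by (intro mult_left_mono) auto
      moreover have "1 * q\<^sup>2 \<le> (p + 1 - q) * q\<^sup>2" using assms(3) by (intro mult_right_mono) auto
      moreover have "m * (3 * m - 11) \<le> (2 * q - 1) * (3 * (2 * q - 1) - 11)"
        using mq m by (intro mult_mono) auto
      ultimately have 1: "q * q\<^sup>2 + q\<^sup>2 \<le> (2 * q - 1) * (3 * (2 * q - 1) - 11)"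
        using bound by linarith
      have 2: "q * q\<^sup>2 + q\<^sup>2 - (2 * q - 1) * (3 * (2 * q - 1) - 11) = q * (q * (q - 11) + 34) - 14"
        by (simp add: power2_eq_square algebra_simps)
      have "16 \<le> q * (q - 11) + 34"
      proof (cases "11 \<le> q")
        case True
        then have "0 \<le> q * (q - 11)" by simp
        then show ?thesis by simp
      next
        case False
        then have "q = 9 \<or> q = 10" using q9 by auto
        then show ?thesis by auto
      qed
      then have "9 * 16 \<le> q * (q * (q - 11) + 34)" using q9 by (intro mult_mono) auto
      then show False using 1 2 by linarith
    qed
  qed
  then show ?thesis using assms by auto
qed

text \<open>
  The sum of squared codegrees is the sum of $c(u) + c(v)$ over the nonadjacent pairs, and the number of these
  pairs is half the sum of the codegrees.
\<close>

lemma sum_codegree_le_sum_squares: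
  assumes "finite V" "sym A"
    and ore: "\<And>u v. u \<in> V \<Longrightarrow> v \<in> non_nbrs A V u \<Longrightarrow>
        m \<le> card (non_nbrs A V u) + card (non_nbrs A V v)"
  shows "m * (\<Sum>v\<in>V. card (non_nbrs A V v)) \<le> 2 * (\<Sum>v\<in>V. (card (non_nbrs A V v))\<^sup>2)"
proof -
  define c where "c v = card (non_nbrs A V v)" for v
  define E where "E = Sigma V (non_nbrs A V)"
  have fin: "finite (non_nbrs A V v)" for v using assms(1) by (simp add: non_nbrs_def)
  have cardE: "card E = (\<Sum>v\<in>V. c v)"
    unfolding E_def c_def using assms(1) fin by (simp add: card_SigmaI)
  have fst: "(\<Sum>v\<in>V. (c v)\<^sup>2) = (\<Sum>e\<in>E. c (fst e))"
  proof -
    have "(\<Sum>v\<in>V. (c v)\<^sup>2) = (\<Sum>v\<in>V. \<Sum>w\<in>non_nbrs A V v. c v)"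
      by (simp add: c_def power2_eq_square)
    also have "\<dots> = (\<Sum>e\<in>E. c (fst e))"
      unfolding E_def using assms(1) fin by (subst sum.Sigma) (auto simp: case_prod_beta)
    finally show ?thesis .
  qed
  have "(\<Sum>e\<in>E. c (fst e)) = (\<Sum>e\<in>E. c (snd e))"
    by (rule sum.reindex_bij_witness[of _ prod.swap prod.swap])
      (use assms(2) in \<open>auto simp: E_def non_nbrs_def dest: symD\<close>)
  then have "2 * (\<Sum>v\<in>V. (c v)\<^sup>2) = (\<Sum>e\<in>E. c (fst e) + c (snd e))"
    using fst by (simp add: sum.distrib)
  moreover have "(\<Sum>e\<in>E. m) \<le> (\<Sum>e\<in>E. c (fst e) + c (snd e))"
    using ore by (intro sum_mono) (auto simp: E_def c_def)
  ultimately show ?thesis using cardE by (simp add: c_def mult.commute)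
qed

text \<open>
  A set $Z$ meets at least $\sum_{z \in Z} c(z) - \binom{|Z|}{2}$ edges of the complement.
\<close>

lemma sum_codegree_ge:
  assumes "finite V" "sym A" "Z \<subseteq> V"
  shows "2 * (\<Sum>z\<in>Z. card (non_nbrs A V z)) \<le> (\<Sum>v\<in>V. card (non_nbrs A V v)) + card Z * (card Z - 1)"
proof -
  have finZ: "finite Z" using assms finite_subset by blast
  have fin: "finite (non_nbrs A V v)" for v using assms(1) by (simp add: non_nbrs_def)
  have "(\<Sum>z\<in>Z. card (non_nbrs A V z)) \<le> (\<Sum>z\<in>Z. card {v \<in> V - Z. v \<in> non_nbrs A V z} + (card Z - 1))"
  proof (rule sum_mono)
    fix z assume z: "z \<in> Z"
    have "non_nbrs A V z \<subseteq> {v \<in> V - Z. v \<in> non_nbrs A V z} \<union> (Z - {z})"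
      by (auto simp: non_nbrs_def)
    then have "card (non_nbrs A V z) \<le> card ({v \<in> V - Z. v \<in> non_nbrs A V z} \<union> (Z - {z}))"
      using assms(1) finZ by (intro card_mono) auto
    also have "\<dots> \<le> card {v \<in> V - Z. v \<in> non_nbrs A V z} + card (Z - {z})" by (rule card_Un_le)
    finally show "card (non_nbrs A V z) \<le> card {v \<in> V - Z. v \<in> non_nbrs A V z} + (card Z - 1)"
      using z finZ by simp
  qed
  also have "\<dots> = (\<Sum>z\<in>Z. card {v \<in> V - Z. v \<in> non_nbrs A V z}) + card Z * (card Z - 1)"
    by (simp add: sum.distrib)
  also have "(\<Sum>z\<in>Z. card {v \<in> V - Z. v \<in> non_nbrs A V z}) =
      (\<Sum>v\<in>V - Z. card {z \<in> Z. v \<in> non_nbrs A V z})"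
    using assms(1) finZ by (intro sum_multicount_gen) auto
  also have "\<dots> \<le> (\<Sum>v\<in>V - Z. card (non_nbrs A V v))"
    using fin assms(2,3) by (intro sum_mono card_mono) (auto simp: non_nbrs_def dest: symD)
  finally have "(\<Sum>z\<in>Z. card (non_nbrs A V z))
      \<le> (\<Sum>v\<in>V - Z. card (non_nbrs A V v)) + card Z * (card Z - 1)" by simp
  moreover have "(\<Sum>v\<in>V. card (non_nbrs A V v)) =
      (\<Sum>v\<in>V - Z. card (non_nbrs A V v)) + (\<Sum>z\<in>Z. card (non_nbrs A V z))"
    using sum.subset_diff[OF assms(3,1)] by blast
  ultimately show ?thesis by linarith
qed

text \<open>
  By \<open>zagreb_bound_int\<close> the two codegree bounds in \<open>non_hamiltonian_codegrees\<close> can only be $q = 2$ and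
  $p = m - 2$. The vertices of $Q$ attain codegree $m - 2$ already within $U$; as this is the largest codegree in
  $V$, they have no non-neighbour outside $U$. This later locates the set $S$.
\<close>

lemma two_extreme_codegrees:
  fixes m :: nat
  assumes fin: "finite V" and "sym A" "irrefl A" "U \<subseteq> V" "card U = m + 2" and m: "17 \<le> m"
    and ab: "a \<in> U" "b \<in> U" "a \<noteq> b" "\<not> hamiltonian_path A U a b"
    and bound: "int (\<Sum>v\<in>V. (card (non_nbrs A V v))\<^sup>2) \<le> int m * (3 * int m - 11)"
    and small: "\<And>v. v \<in> V \<Longrightarrow> card (non_nbrs A V v) \<le> m - 2"
  obtains x y where "x \<in> U" "y \<in> U" "x \<noteq> y"
    "card (non_nbrs A V x) = m - 2" "card (non_nbrs A V y) = m - 2"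
    "non_nbrs A V x \<subseteq> U" "non_nbrs A V y \<subseteq> U"
proof -
  have finU: "finite U" using assms finite_subset by blast
  have finn: "finite (non_nbrs A V v)" for v using fin by (simp add: non_nbrs_def)
  define c where "c v = card (non_nbrs A V v)" for v
  have UV: "card (non_nbrs A U v) \<le> c v" for v
    unfolding c_def using finn assms(4) by (intro card_mono non_nbrs_antimono) auto
  have three: "3 \<le> card U" using assms(5) m by simp
  show thesis
  proof (rule non_hamiltonian_codegrees[OF finU assms(2,3) ab(1-3) three ab(4)])
    fix p q u P Q
    assume pq: "q \<le> p" "card U \<le> p + q + 2"
      and u: "u \<in> U" "p \<le> card (non_nbrs A U u)"
      and P: "P \<subseteq> U" "p + 1 \<le> card P" "\<And>z. z \<in> P \<Longrightarrow> q \<le> card (non_nbrs A U z)"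
      and Q: "Q \<subseteq> U" "q \<le> card Q" "\<And>z. z \<in> Q \<Longrightarrow> p \<le> card (non_nbrs A U z)"
    have pm: "p \<le> m - 2" using u UV[of u] small[of u] assms(4) unfolding c_def by auto
    obtain Q' where Q': "Q' \<subseteq> Q" "card Q' = q" using Q(2) by (meson obtain_subset_with_card_n)
    have finQ': "finite Q'" using Q' Q(1) finU by (meson finite_subset)
    have "card P - card Q' \<le> card (P - Q')" by (rule diff_card_le_card_Diff[OF finQ'])
    then have "p + 1 - q \<le> card (P - Q')" using P(2) Q'(2) by linarith
    then obtain P' where P': "P' \<subseteq> P - Q'" "card P' = p + 1 - q" by (meson obtain_subset_with_card_n)
    have finP': "finite P'" using P' P(1) finU by (meson finite_subset Diff_subset)
    have "q * p\<^sup>2 + (p + 1 - q) * q\<^sup>2 = (\<Sum>z\<in>Q'. p\<^sup>2) + (\<Sum>z\<in>P'. q\<^sup>2)"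
      using Q' P' by simp
    also have "\<dots> \<le> (\<Sum>z\<in>Q'. (c z)\<^sup>2) + (\<Sum>z\<in>P'. (c z)\<^sup>2)"
    proof (intro add_mono sum_mono power_mono)
      fix z
      show "p \<le> c z" if "z \<in> Q'" using that Q(3) Q' UV[of z] by (meson le_trans subsetD)
      show "q \<le> c z" if "z \<in> P'" using that P(3)[of z] P' UV[of z] by auto
    qed auto
    also have "\<dots> = (\<Sum>z\<in>Q' \<union> P'. (c z)\<^sup>2)"
      using finQ' finP' P'(1) by (subst sum.union_disjoint) auto
    also have "\<dots> \<le> (\<Sum>z\<in>V. (c z)\<^sup>2)"
      using fin P' P(1) Q' Q(1) assms(4) by (intro sum_mono2) auto
    finally have "q * p\<^sup>2 + (p + 1 - q) * q\<^sup>2 \<le> (\<Sum>z\<in>V. (c z)\<^sup>2)" .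
    then have "int (q * p\<^sup>2 + (p + 1 - q) * q\<^sup>2) \<le> int m * (3 * int m - 11)"
      using bound unfolding c_def by linarith
    moreover have "int (q * p\<^sup>2 + (p + 1 - q) * q\<^sup>2) =
        int q * (int p)\<^sup>2 + (int p + 1 - int q) * (int q)\<^sup>2"
      using pq(1) by (simp add: of_nat_diff)
    ultimately have "int q * (int p)\<^sup>2 + (int p + 1 - int q) * (int q)\<^sup>2
        \<le> int m * (3 * int m - 11)" by linarith
    moreover have "17 \<le> int m" "0 \<le> int q" "int q \<le> int p" "int m \<le> int p + int q"
      "int p \<le> int m - 2"
      using m pq pm assms(5) by auto
    ultimately have "int q = 2 \<and> int p = int m - 2" by (intro zagreb_bound_int)
    then have q2: "q = 2" and p2: "p = m - 2" using m by auto
    obtain x y where xy: "Q' = {x, y}" "x \<noteq> y" using Q'(2) q2 by (auto simp: card_2_iff)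
    have "card (non_nbrs A V z) = m - 2 \<and> non_nbrs A V z \<subseteq> U \<and> z \<in> U" if "z \<in> Q'" for z
    proof -
      have z: "z \<in> Q" "z \<in> U" "z \<in> V" using that Q' Q(1) assms(4) by auto
      have 1: "m - 2 \<le> card (non_nbrs A U z)" using Q(3)[OF z(1)] p2 by simp
      have 2: "card (non_nbrs A V z) \<le> m - 2" using small z by blast
      have "non_nbrs A U z = non_nbrs A V z"
        using 1 2 finn assms(4) by (intro card_seteq non_nbrs_antimono) auto
      then show ?thesis using 1 2 z by (auto simp: non_nbrs_def)
    qed
    then show thesis using that[of x y] xy by auto
  qed
qed

text \<open>
  By \<open>sum_codegree_le_sum_squares\<close> the codegrees sum up to at most $6m - 22$. Two nonadjacent vertices outside
  $\{x, y\}$ would, by \<open>sum_codegree_ge\<close> for the four vertices, raise the sum to $6m - 20$. So the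
  non-neighbours of any third vertex $w$ are among $x$, $y$, and as $c(w) \<ge> m - (m - 2) = 2$ unless $c(w) = 0$, they
  are both or none.
\<close>

lemma two_extreme_codegrees_structure:
  fixes m :: nat
  assumes fin: "finite V" and "sym A" and m: "17 \<le> m"
    and bound: "int (\<Sum>v\<in>V. (card (non_nbrs A V v))\<^sup>2) \<le> int m * (3 * int m - 11)"
    and ore: "\<And>u v. u \<in> V \<Longrightarrow> v \<in> non_nbrs A V u \<Longrightarrow>
        m \<le> card (non_nbrs A V u) + card (non_nbrs A V v)"
    and xy: "x \<in> V" "y \<in> V" "x \<noteq> y"
      "card (non_nbrs A V x) = m - 2" "card (non_nbrs A V y) = m - 2"
  obtains W where "W \<subseteq> V - {x, y}" "non_nbrs A V x - {y} = W" "non_nbrs A V y - {x} = W"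
    "\<And>w. w \<in> W \<Longrightarrow> non_nbrs A V w = {x, y}"
    "\<And>v. v \<in> V - {x, y} - W \<Longrightarrow> non_nbrs A V v = {}"
proof -
  define c where "c v = card (non_nbrs A V v)" for v
  define s where "s = (\<Sum>v\<in>V. c v)"
  have finn: "finite (non_nbrs A V v)" for v using fin by (simp add: non_nbrs_def)
  have sym_nn: "v \<in> non_nbrs A V u \<longleftrightarrow> u \<in> non_nbrs A V v" if "u \<in> V" "v \<in> V" for u v
    using that assms(2) by (auto simp: non_nbrs_def dest: symD)
  have "int (m * s) \<le> 2 * (int m * (3 * int m - 11))"
    using sum_codegree_le_sum_squares[OF fin assms(2) ore] bound unfolding c_def s_def by linarith
  then have "int m * int s \<le> int m * (6 * int m - 22)"
    by (simp add: algebra_simps)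
  then have total: "int s \<le> 6 * int m - 22" using m by simp
  have indep: "u \<in> {x, y} \<or> v \<in> {x, y}" if uv: "u \<in> V" "v \<in> non_nbrs A V u" for u v
  proof (rule ccontr)
    assume not: "\<not> (u \<in> {x, y} \<or> v \<in> {x, y})"
    have uv': "v \<in> V" "u \<noteq> v" using uv by (auto simp: non_nbrs_def)
    let ?Z = "{x, y, u, v}"
    have "card ?Z = 4" using not uv' xy(3) by auto
    moreover have "(\<Sum>z\<in>?Z. c z) = c x + c y + c u + c v"
      using not uv' xy(3) by auto
    moreover have "m \<le> c u + c v" using ore[OF uv] unfolding c_def .
    moreover have "2 * (\<Sum>z\<in>?Z. c z) \<le> s + card ?Z * (card ?Z - 1)"
      using sum_codegree_ge[OF fin assms(2), of ?Z] xy uv(1) uv'(1) unfolding c_def s_def by blast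
    ultimately have "2 * (2 * (m - 2) + m) \<le> s + 12"
      using xy(4,5) unfolding c_def by auto
    then have "6 * m \<le> s + 20" using m by arith
    then show False using total by linarith
  qed
  have sub: "non_nbrs A V w = {x, y}" if w: "w \<in> V - {x, y}" "non_nbrs A V w \<noteq> {}" for w
  proof -
    have le: "non_nbrs A V w \<subseteq> {x, y}" using indep[of w] w(1) by blast
    obtain z where z: "z \<in> non_nbrs A V w" using w(2) by blast
    then have "m \<le> c w + c z" using ore[of w z] w(1) unfolding c_def by blast
    moreover have "c z = m - 2" using z le xy(4,5) unfolding c_def by auto
    ultimately have "2 \<le> card (non_nbrs A V w)" using m unfolding c_def by linarith
    then show ?thesis using le xy(3) by (intro card_seteq) auto
  qed
  define W where "W = {w \<in> V - {x, y}. non_nbrs A V w \<noteq> {}}"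
  show thesis
  proof (rule that[of W])
    show "non_nbrs A V x - {y} = W"
    proof (rule set_eqI)
      fix w
      have "w \<in> W \<Longrightarrow> x \<in> non_nbrs A V w" using sub[of w] by (auto simp: W_def)
      then show "w \<in> non_nbrs A V x - {y} \<longleftrightarrow> w \<in> W"
        using sym_nn[of x w] xy(1) by (auto simp: W_def non_nbrs_def)
    qed
    show "non_nbrs A V y - {x} = W"
    proof (rule set_eqI)
      fix w
      have "w \<in> W \<Longrightarrow> y \<in> non_nbrs A V w" using sub[of w] by (auto simp: W_def)
      then show "w \<in> non_nbrs A V y - {x} \<longleftrightarrow> w \<in> W"
        using sym_nn[of y w] xy(2) by (auto simp: W_def non_nbrs_def)
    qed
  qed (use sub in \<open>auto simp: W_def\<close>)
qed

section \<open>Recognising a join\<close>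

lemma digraph_iso_by_adjacency:
  assumes "pair_wf_digraph G" "pair_wf_digraph K" and bij: "bij_betw f (pverts G) (pverts K)"
    and adj: "\<And>u v. u \<in> pverts G \<Longrightarrow> v \<in> pverts G \<Longrightarrow> (u, v) \<in> parcs G \<longleftrightarrow> (f u, f v) \<in> parcs K"
  shows "digraph_iso (with_proj G) (with_proj K)"
proof -
  interpret G: pair_wf_digraph G by fact
  interpret K: pair_wf_digraph K by fact
  have "parcs K = map_prod f f ` parcs G"
  proof (intro equalityI subsetI)
    fix e assume e: "e \<in> parcs K"
    obtain c d where cd: "e = (c, d)" by (cases e)
    then have "c \<in> f ` pverts G" "d \<in> f ` pverts G"
      using e K.in_arcsD1 K.in_arcsD2 bij by (auto simp: bij_betw_def)
    then obtain u v where "u \<in> pverts G" "v \<in> pverts G" "e = (f u, f v)" using cd by blast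
    then show "e \<in> map_prod f f ` parcs G" using e adj by force
  next
    fix e assume "e \<in> map_prod f f ` parcs G"
    then obtain u v where "(u, v) \<in> parcs G" "e = (f u, f v)" by auto
    then show "e \<in> parcs K" using adj G.in_arcsD1 G.in_arcsD2 by blast
  qed
  then show ?thesis using digraph_iso_pair_iff[OF assms(1)] bij by blast
qed

lemma parcs_graph_sum:
  "(Inl u, Inl v) \<in> parcs (graph_sum G H) \<longleftrightarrow> (u, v) \<in> parcs G"
  "(Inr x, Inr y) \<in> parcs (graph_sum G H) \<longleftrightarrow> (x, y) \<in> parcs H"
  "(Inl u, Inr y) \<notin> parcs (graph_sum G H)"
  "(Inr x, Inl v) \<notin> parcs (graph_sum G H)"
  by (auto simp: graph_sum_def)

lemma parcs_graph_join:
  "(Inl u, Inl v) \<in> parcs (graph_join G H) \<longleftrightarrow> (u, v) \<in> parcs G"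
  "(Inr x, Inr y) \<in> parcs (graph_join G H) \<longleftrightarrow> (x, y) \<in> parcs H"
  "(Inl u, Inr y) \<in> parcs (graph_join G H) \<longleftrightarrow> u \<in> pverts G \<and> y \<in> pverts H"
  "(Inr x, Inl v) \<in> parcs (graph_join G H) \<longleftrightarrow> v \<in> pverts G \<and> x \<in> pverts H"
  by (auto simp: graph_join_def parcs_graph_sum)

text \<open>
  The universal vertices $C$ form the first factor of the join, the clique $W$ the first summand of the second
  factor, and $R$ the remaining summand $X$. Only the isomorphism $g$ on $R$ has to be given; on $C$ and $W$ any
  bijections do.
\<close>

lemma digraph_iso_join_sum:
  fixes G :: "'a pair_pre_digraph" and X :: "'b pair_pre_digraph"
  assumes G: "pair_graph G" and X: "pair_wf_digraph X"
    and parts: "pverts G = C \<union> W \<union> R" "C \<inter> W = {}" "C \<inter> R = {}" "W \<inter> R = {}"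
    and cards: "card C = r" "card W = s"
    and g: "bij_betw g R (pverts X)"
      "\<And>u v. u \<in> R \<Longrightarrow> v \<in> R \<Longrightarrow> (u, v) \<in> parcs G \<longleftrightarrow> (g u, g v) \<in> parcs X"
    and universal: "\<And>u v. u \<in> C \<Longrightarrow> v \<in> pverts G \<Longrightarrow> u \<noteq> v \<Longrightarrow> (u, v) \<in> parcs G"
    and clique: "\<And>u v. u \<in> W \<Longrightarrow> v \<in> W \<Longrightarrow> u \<noteq> v \<Longrightarrow> (u, v) \<in> parcs G"
    and apart: "\<And>u v. u \<in> W \<Longrightarrow> v \<in> R \<Longrightarrow> (u, v) \<notin> parcs G"
  shows "digraph_iso (with_proj G)
    (with_proj (graph_join (complete_graph r) (graph_sum (complete_graph s) X)))"
proof -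
  interpret G: pair_graph G by fact
  interpret X: pair_wf_digraph X by fact
  let ?K = "graph_join (complete_graph r) (graph_sum (complete_graph s) X)"
  have "finite C" "finite W" using G.pair_finite_verts parts(1) by auto
  then obtain p q where p: "bij_betw p C {..<r}" and q: "bij_betw q W {..<s}"
    using cards finite_same_card_bij[of C "{..<r}"] finite_same_card_bij[of W "{..<s}"] by auto
  define f where "f v = (if v \<in> C then Inl (p v) else if v \<in> W then Inr (Inl (q v)) else Inr (Inr (g v)))" for v
  have fC: "f v = Inl (p v)" if "v \<in> C" for v using that by (simp add: f_def)
  have fW: "f v = Inr (Inl (q v))" if "v \<in> W" for v using that parts by (auto simp: f_def)
  have fR: "f v = Inr (Inr (g v))" if "v \<in> R" for v using that parts by (auto simp: f_def)
  have pC: "p v < r" if "v \<in> C" for v using p that by (auto simp: bij_betw_def)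
  have qW: "q v < s" if "v \<in> W" for v using q that by (auto simp: bij_betw_def)
  have gR: "g v \<in> pverts X" if "v \<in> R" for v using g(1) that by (auto simp: bij_betw_def)
  have pinj: "p u = p v \<longleftrightarrow> u = v" if "u \<in> C" "v \<in> C" for u v
    using p that by (auto simp: bij_betw_def inj_on_def)
  have qinj: "q u = q v \<longleftrightarrow> u = v" if "u \<in> W" "v \<in> W" for u v
    using q that by (auto simp: bij_betw_def inj_on_def)
  have ginj: "g u = g v \<longleftrightarrow> u = v" if "u \<in> R" "v \<in> R" for u v
    using g(1) that by (auto simp: bij_betw_def inj_on_def)
  have vertsK: "pverts ?K = {..<r} <+> ({..<s} <+> pverts X)"
    by (simp add: graph_join_def graph_sum_def complete_graph_def)
  have arcsK:
    "(Inl i, Inl j) \<in> parcs ?K \<longleftrightarrow> i < r \<and> j < r \<and> i \<noteq> j"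
    "(Inl i, Inr c) \<in> parcs ?K \<longleftrightarrow> i < r \<and> c \<in> {..<s} <+> pverts X"
    "(Inr c, Inl i) \<in> parcs ?K \<longleftrightarrow> i < r \<and> c \<in> {..<s} <+> pverts X"
    "(Inr (Inl i), Inr (Inl j)) \<in> parcs ?K \<longleftrightarrow> i < s \<and> j < s \<and> i \<noteq> j"
    "(Inr (Inl i), Inr (Inr x)) \<notin> parcs ?K"
    "(Inr (Inr x), Inr (Inl i)) \<notin> parcs ?K"
    "(Inr (Inr x), Inr (Inr y)) \<in> parcs ?K \<longleftrightarrow> (x, y) \<in> parcs X" for i j c x y
    by (auto simp: parcs_graph_join parcs_graph_sum) (auto simp: complete_graph_def graph_sum_def)
  have wfK: "pair_wf_digraph ?K"
    by unfold_locales
      (auto simp: graph_join_def graph_sum_def complete_graph_def dest: X.in_arcsD1 X.in_arcsD2)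
  show ?thesis
  proof (rule digraph_iso_by_adjacency[OF G.pair_wf_digraph_axioms wfK])
    show "bij_betw f (pverts G) (pverts ?K)"
      unfolding bij_betw_def
    proof
      show "inj_on f (pverts G)"
      proof (rule inj_onI)
        fix u v assume "u \<in> pverts G" "v \<in> pverts G" "f u = f v"
        then show "u = v"
          unfolding parts(1) by (elim UnE) (simp_all add: fC fW fR pinj qinj ginj)
      qed
      have "f ` C = Inl ` p ` C" "f ` W = Inr ` Inl ` q ` W" "f ` R = Inr ` Inr ` g ` R"
        unfolding image_image by (auto intro!: image_cong simp: fC fW fR)
      moreover have "p ` C = {..<r}" "q ` W = {..<s}" "g ` R = pverts X"
        using p q g(1) by (simp_all add: bij_betw_def)
      ultimately show "f ` pverts G = pverts ?K"
        unfolding parts(1) vertsK Plus_def image_Un by (simp add: Un_assoc)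
    qed
  next
    fix u v assume uv: "u \<in> pverts G" "v \<in> pverts G"
    have sym: "(a, b) \<in> parcs G \<longleftrightarrow> (b, a) \<in> parcs G" for a b using G.arcs_symmetric by blast
    have irr: "(a, a) \<notin> parcs G" for a using G.pair_no_loops[of "(a, a)"] by auto
    consider "u \<in> C" | "v \<in> C" | "u \<in> W" "v \<in> W" | "u \<in> W" "v \<in> R" | "u \<in> R" "v \<in> W" | "u \<in> R" "v \<in> R"
      using uv unfolding parts(1) by blast
    then show "(u, v) \<in> parcs G \<longleftrightarrow> (f u, f v) \<in> parcs ?K"
    proof cases
      case 1
      then have "(u, v) \<in> parcs G \<longleftrightarrow> u \<noteq> v" using universal uv irr by blast
      moreover have "(f u, f v) \<in> parcs ?K \<longleftrightarrow> u \<noteq> v"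
        using 1 uv(2) parts unfolding parts(1)
        by (elim UnE) (auto simp: fC fW fR arcsK pC qW gR pinj)
      ultimately show ?thesis by simp
    next
      case 2
      then have "(u, v) \<in> parcs G \<longleftrightarrow> u \<noteq> v" using universal[of v u] uv irr sym by blast
      moreover have "(f u, f v) \<in> parcs ?K \<longleftrightarrow> u \<noteq> v"
        using 2 uv(1) parts unfolding parts(1)
        by (elim UnE) (auto simp: fC fW fR arcsK pC qW gR pinj)
      ultimately show ?thesis by simp
    next
      case 3
      then have "(u, v) \<in> parcs G \<longleftrightarrow> u \<noteq> v" using clique irr by blast
      then show ?thesis using 3 by (auto simp: fW arcsK qW qinj)
    next
      case 4
      then show ?thesis using apart by (auto simp: fW fR arcsK)
    next
      case 5
      then show ?thesis using apart[of v u] sym by (auto simp: fW fR arcsK)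
    next
      case 6
      then show ?thesis using g(2) by (simp add: fR arcsK)
    qed
  qed
qed

lemma pair_wf_digraph_complete_graph: "pair_wf_digraph (complete_graph n)"
  by unfold_locales (auto simp: complete_graph_def)

lemma pair_wf_digraph_graph_copies:
  assumes "pair_wf_digraph X"
  shows "pair_wf_digraph (graph_copies t X)"
proof -
  interpret pair_wf_digraph X by fact
  show ?thesis by unfold_locales (auto simp: graph_copies_def dest: in_arcsD1 in_arcsD2)
qed

section \<open>Spanning trees with prescribed leaves\<close>

lemma k_leaf_connectedI:
  assumes "pair_graph G" "k + 1 \<le> card (pverts G)"
    and tree: "\<And>S. S \<subseteq> pverts G \<Longrightarrow> card S = k \<Longrightarrow> tree_with_leaves (parcs G) (pverts G) S"
  shows "k_leaf_connected k G"
  unfolding k_leaf_connected_def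
proof (intro conjI allI impI)
  fix S assume "S \<subseteq> pverts G" "card S = k"
  then obtain T where T: "undirected_tree T" "pverts T = pverts G" "parcs T \<subseteq> parcs G" "leaves T = S"
    using tree unfolding tree_with_leaves_def by blast
  interpret G: pair_graph G by fact
  interpret T: pair_graph T using T(1) by (simp add: undirected_tree_def)
  have "spanning (with_proj T) (with_proj G)"
    using T(2,3) G.wf_digraph_axioms T.wf_digraph_axioms
    by (auto simp: spanning_def subgraph_def compatible_def)
  then show "\<exists>T. undirected_tree T \<and> spanning (with_proj T) (with_proj G) \<and> leaves T = S"
    using T by blast
qed (fact assms(2))

text \<open>
  Every vertex of $R$ has a neighbour outside $S$, which is an inner vertex of the path.
\<close>

lemma tree_of_hamiltonian_path:
  assumes "pair_graph G" and S: "S \<subseteq> pverts G" "S = insert a (insert b R)" "a \<noteq> b" "a \<notin> R" "b \<notin> R"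
    and deg: "\<And>s. s \<in> S \<Longrightarrow> card S < degree G s"
    and path: "hamiltonian_path (parcs G) (pverts G - R) a b"
  shows "tree_with_leaves (parcs G) (pverts G) S"
proof -
  interpret pair_graph G by fact
  have sym: "sym (parcs G)" using pair_graph_sym_irrefl[OF assms(1)] by blast
  have finS: "finite S" using S(1) pair_finite_verts finite_subset by blast
  have "tree_with_leaves (parcs G) ((pverts G - R) \<union> R) ({a, b} \<union> R)"
  proof (rule tree_with_leaves_attach[OF tree_with_leaves_path[OF sym path S(3)] sym])
    fix s assume s: "s \<in> R"
    have "\<not> parcs G `` {s} \<subseteq> S"
      using deg[of s] card_mono[OF finS, of "parcs G `` {s}"] s S(2) by (force simp: degree_eq_card)
    then show "\<exists>x\<in>pverts G - R - {a, b}. (s, x) \<in> parcs G"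
      using in_arcsD2 S(2) by blast
  qed (use S finS in \<open>auto\<close>)
  moreover have "(pverts G - R) \<union> R = pverts G" "{a, b} \<union> R = S" using S by auto
  ultimately show ?thesis by simp
qed

text \<open>
  The legs of the spider are $c$, $x$, $s_1$ and $c$, $y$, $s_2$ and a Hamiltonian path of $W \cup \{c, s_3\}$ from $c$ to $s_3$;
  the other vertices of $S$ are hung onto $x$. In $H$ that path exists because $W \cup \{c, s_3\}$ is a clique. It
  descends to $G$ since the vertices of $W$ are adjacent neither to $x$ nor to $y$ and so have at most $|S| - 1$
  neighbours outside the path; the ends $c$ and $s_3$ have up to two more, which is where
  \<open>crossing\<close> with its weaker condition at the ends is needed.
\<close>

lemma spider_tree:
  assumes G: "pair_graph G" and steps: "(closure_step l)\<^sup>*\<^sup>* G H"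
    and V: "pverts G = insert c S \<union> W \<union> {x, y}" "c \<notin> S" "insert c S \<inter> W = {}"
      "{x, y} \<inter> (insert c S \<union> W) = {}" "x \<noteq> y"
    and k: "3 \<le> card S" and "W \<noteq> {}" and l: "card W + 2 * card S + 2 \<le> l"
    and non_nbrs_W: "\<And>w. w \<in> W \<Longrightarrow> non_nbrs (parcs H) (pverts G) w = {x, y}"
    and non_nbrs_C: "\<And>v. v \<in> insert c S \<Longrightarrow> non_nbrs (parcs H) (pverts G) v = {}"
    and nbrs_xy: "parcs G `` {x} = insert c S" "parcs G `` {y} = insert c S"
  shows "tree_with_leaves (parcs G) (pverts G) S"
proof -
  interpret pair_graph G by fact
  have symG: "sym (parcs G)" using pair_graph_sym_irrefl[OF G] by blast
  have H: "pair_graph H" "pverts H = pverts G" using closure_steps_pair_graph[OF steps G] by auto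
  then interpret H: pair_graph H by simp
  have fin: "finite S" "finite W" using V(1) pair_finite_verts by auto
  obtain S3 where "S3 \<subseteq> S" "card S3 = 3" using k by (meson obtain_subset_with_card_n)
  then obtain s1 s2 s3 where s: "s1 \<in> S" "s2 \<in> S" "s3 \<in> S" "s1 \<noteq> s2" "s1 \<noteq> s3" "s2 \<noteq> s3"
    by (auto simp: card_3_iff)
  let ?U = "insert c (insert s3 W)"
  have cs3: "c \<noteq> s3" using s V(2) by auto
  have cardU: "card ?U = card W + 2"
    using fin V(2,3) s(3) by (auto simp: card_insert_if)
  have pathH: "hamiltonian_path (parcs H) ?U c s3"
  proof (rule hamiltonian_path_complete)
    fix u v assume uv: "u \<in> ?U" "v \<in> ?U" "u \<noteq> v"
    have "v \<in> pverts G" "v \<notin> {x, y}" "u \<in> insert c S \<union> W" using uv V s by auto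
    then have "v \<notin> non_nbrs (parcs H) (pverts G) u" using non_nbrs_W non_nbrs_C by blast
    then show "(u, v) \<in> parcs H" using uv(3) \<open>v \<in> pverts G\<close> by (simp add: non_nbrs_def)
  qed (use fin cs3 in auto)
  have lossW: "card (parcs H `` {w} - ?U) \<le> card S - 1" if w: "w \<in> W" for w
  proof -
    have "v \<in> S - {s3}" if v: "v \<in> parcs H `` {w} - ?U" for v
    proof -
      have "v \<in> pverts G" using v H.in_arcsD2 H(2) by auto
      moreover have "v \<notin> {x, y}" using v non_nbrs_W[OF w] by (auto simp: non_nbrs_def)
      ultimately show ?thesis using v V(1) by auto
    qed
    then have "card (parcs H `` {w} - ?U) \<le> card (S - {s3})"
      using fin by (intro card_mono) auto
    then show ?thesis using fin s(3) by simp
  qed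
  have loss_end: "card (parcs H `` {e} - ?U) \<le> card S + 1" for e
  proof -
    have "parcs H `` {e} - ?U \<subseteq> insert x (insert y (S - {s3}))"
    proof
      fix v assume v: "v \<in> parcs H `` {e} - ?U"
      then have "v \<in> pverts G" using H.in_arcsD2 H(2) by auto
      then show "v \<in> insert x (insert y (S - {s3}))" using v V(1) by auto
    qed
    then have "card (parcs H `` {e} - ?U) \<le> card (insert x (insert y (S - {s3})))"
      using fin by (intro card_mono) auto
    also have "\<dots> = card S + 1"
      using fin V(4,5) s(3) k by (auto simp: card_insert_if)
    finally show ?thesis .
  qed
  have "hamiltonian_path (parcs G) ?U c s3"
  proof (rule hamiltonian_path_of_closure[OF steps G _ _ pathH])
    show "?U \<subseteq> pverts G" using V(1) s by auto
    have "0 < card W" using fin \<open>W \<noteq> {}\<close> by (simp add: card_gt_0_iff)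
    then show "3 \<le> card ?U" using cardU by simp
    fix u v assume uv: "u \<in> ?U" "v \<in> ?U" "u \<noteq> v" "{u, v} \<noteq> {c, s3}"
    then consider "u \<in> W" "v \<in> W" "{u, v} \<inter> {c, s3} = {}" | "u \<in> W" "{u, v} \<inter> {c, s3} \<noteq> {}"
      | "v \<in> W" "{u, v} \<inter> {c, s3} \<noteq> {}" using V(2,3) s(3) by blast
    then show "card ?U + 1 + card (parcs H `` {u} - ?U) + card (parcs H `` {v} - ?U)
        \<le> l + (if {u, v} \<inter> {c, s3} \<noteq> {} then 1 else 0)"
    proof cases
      case 1
      then show ?thesis using lossW[of u] lossW[of v] l k unfolding cardU by simp
    next
      case 2
      then show ?thesis using lossW[of u] loss_end[of v] l k unfolding cardU by simp
    next
      case 3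
      then show ?thesis using lossW[of v] loss_end[of u] l k unfolding cardU by simp
    qed
  qed
  then have path: "tree_with_leaves (parcs G) ?U {c, s3}"
    by (rule tree_with_leaves_path[OF symG _ cs3])
  have x_nbr: "(x, v) \<in> parcs G" "(v, x) \<in> parcs G" if "v \<in> insert c S" for v
    using that nbrs_xy(1) symG by (auto dest: symD)
  have y_nbr: "(y, v) \<in> parcs G" "(v, y) \<in> parcs G" if "v \<in> insert c S" for v
    using that nbrs_xy(2) symG by (auto dest: symD)
  have "tree_with_leaves (parcs G) (insert x ?U) (insert x ({c, s3} - {c}))"
    by (rule tree_with_leaves_pendant[OF path]) (use V s cs3 x_nbr in auto)
  moreover have "insert x ({c, s3} - {c}) = {s3, x}" using cs3 by auto
  ultimately have t: "tree_with_leaves (parcs G) (insert x ?U) {s3, x}" by simp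
  have "tree_with_leaves (parcs G) (insert y (insert x ?U)) (insert y ({s3, x} - {c}))"
    by (rule tree_with_leaves_pendant[OF t]) (use V s cs3 y_nbr in auto)
  moreover have "insert y ({s3, x} - {c}) = {s3, x, y}" using cs3 V(4) by auto
  ultimately have t: "tree_with_leaves (parcs G) (insert y (insert x ?U)) {s3, x, y}" by simp
  have "tree_with_leaves (parcs G) (insert s1 (insert y (insert x ?U))) (insert s1 ({s3, x, y} - {x}))"
    by (rule tree_with_leaves_pendant[OF t]) (use V s cs3 x_nbr in auto)
  moreover have "insert s1 ({s3, x, y} - {x}) = {s1, s3, y}" using V(4,5) s by auto
  ultimately have t: "tree_with_leaves (parcs G) (insert s1 (insert y (insert x ?U))) {s1, s3, y}"
    by simp
  let ?U' = "insert s2 (insert s1 (insert y (insert x ?U)))"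
  have "tree_with_leaves (parcs G) ?U' (insert s2 ({s1, s3, y} - {y}))"
    by (rule tree_with_leaves_pendant[OF t]) (use V s cs3 y_nbr in auto)
  moreover have "insert s2 ({s1, s3, y} - {y}) = {s1, s2, s3}" using V(4) s by auto
  ultimately have t: "tree_with_leaves (parcs G) ?U' {s1, s2, s3}" by simp
  have "tree_with_leaves (parcs G) (?U' \<union> (S - {s1, s2, s3})) ({s1, s2, s3} \<union> (S - {s1, s2, s3}))"
  proof (rule tree_with_leaves_attach[OF t symG])
    show "\<exists>z\<in>?U' - {s1, s2, s3}. (s, z) \<in> parcs G" if "s \<in> S - {s1, s2, s3}" for s
      using that x_nbr(2)[of s] V(4) s by (intro bexI[of _ x]) auto
  qed (use fin V in auto)
  moreover have "?U' \<union> (S - {s1, s2, s3}) = pverts G" using V(1) s by auto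
  moreover have "{s1, s2, s3} \<union> (S - {s1, s2, s3}) = S" using s by auto
  ultimately show ?thesis by simp
qed

section \<open>Leaf-connectedness and the Zagreb index\<close>

lemma degree_complement_graph:
  assumes "v \<in> pverts G"
  shows "degree (complement_graph G) v = card (non_nbrs (parcs G) (pverts G) v)"
proof -
  have "parcs (complement_graph G) `` {v} = non_nbrs (parcs G) (pverts G) v"
    using assms by (auto simp: complement_graph_def non_nbrs_def)
  then show ?thesis by (simp add: degree_eq_card)
qed

lemma degree_plus_codegree:
  assumes "pair_graph G" "v \<in> pverts G"
  shows "degree G v + card (non_nbrs (parcs G) (pverts G) v) + 1 = card (pverts G)"
proof -
  interpret pair_graph G by fact
  have "parcs G `` {v} \<inter> pverts G = parcs G `` {v}" using in_arcsD2 by auto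
  then show ?thesis
    using card_non_nbrs[OF pair_finite_verts pair_graph_sym_irrefl(2)[OF assms(1)] assms(2)]
    by (simp add: degree_eq_card)
qed

theorem theorem4p1:
  fixes n k :: nat and G :: "'a pair_pre_digraph"
  assumes "2 \<le> k" and "k + 17 \<le> n"
    and "pair_graph G" and "connected (with_proj G)" and "card (pverts G) = n"
    and "k + 1 \<le> min_degree G"
    and "int (first_Zagreb (complement_graph G))
           \<le> (int n - int k) * (3 * (int n - int k) - 11)"
  shows "k_leaf_connected k G \<or>
    digraph_iso (with_proj (l_closure (n + k - 1) G))
      (with_proj (graph_join (complete_graph k)
        (graph_sum (complete_graph (n - k - 2)) (complete_graph 2)))) \<or>
    digraph_iso (with_proj (l_closure (n + k - 1) G))
      (with_proj (graph_join (complete_graph 3)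
        (graph_sum (complete_graph (n - 5)) (graph_copies 2 (complete_graph 1)))))"
proof (cases "k_leaf_connected k G")
  case False
  note G = assms(3)
  interpret G: pair_graph G by fact
  define H where "H = l_closure (n + k - 1) G"
  define V where "V = pverts G"
  define m where "m = n - k"
  have m: "17 \<le> m" "n = m + k" "int m = int n - int k" using assms(2) by (auto simp: m_def)
  have "is_l_closure (n + k - 1) G H"
    unfolding H_def l_closure_def by (rule theI'[OF ex1_l_closure[OF G]])
  then have steps: "(closure_step (n + k - 1))\<^sup>*\<^sup>* G H"
    and closed: "\<not> (\<exists>H'. closure_step (n + k - 1) H H')" by (auto simp: is_l_closure_def)
  have H: "pair_graph H" "pverts H = V"
    using closure_steps_pair_graph[OF steps G] by (auto simp: V_def)
  interpret H: pair_graph H by fact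
  have sub: "parcs G \<subseteq> parcs H" by (rule closure_steps_mono[OF steps])
  note symH = pair_graph_sym_irrefl(1)[OF H(1)] and irrH = pair_graph_sym_irrefl(2)[OF H(1)]
  have fin: "finite V" "card V = n" using G.pair_finite_verts assms(5) by (auto simp: V_def)
  define nn where "nn v = non_nbrs (parcs H) V v" for v
  have finn: "finite (nn v)" for v using fin by (simp add: nn_def non_nbrs_def)
  have degG: "k + 1 \<le> degree G v" if "v \<in> V" for v
  proof -
    have "min_degree G \<le> degree G v"
      unfolding min_degree_def using that G.pair_finite_verts by (auto simp: V_def)
    then show ?thesis using assms(6) by linarith
  qed
  have degH: "degree H v + card (nn v) + 1 = n" if "v \<in> V" for v
    using degree_plus_codegree[OF H(1), of v] that H(2) fin(2) by (simp add: nn_def)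
  have small: "card (nn v) \<le> m - 2" if "v \<in> V" for v
    using degH[OF that] degG[OF that] degree_mono[OF H(1) sub, of v] m by linarith
  \<comment> \<open>Nonadjacent vertices of the closure have degree sum at most $n + k - 2$, and $2(n-1) - (n+k-2) = m$.\<close>
  have ore: "m \<le> card (nn u) + card (nn v)" if "u \<in> V" "v \<in> nn u" for u v
  proof -
    have v: "v \<in> V" "u \<noteq> v" "(u, v) \<notin> parcs H" using that by (auto simp: nn_def non_nbrs_def)
    then have "degree H u + degree H v < n + k - 1"
      using closed closure_step.intros[of u H v "n + k - 1"] that(1) H(2) by (meson not_le)
    then show ?thesis using degH[OF that(1)] degH[OF v(1)] m assms(1) by linarith
  qed
  have bound: "int (\<Sum>v\<in>V. (card (nn v))\<^sup>2) \<le> int m * (3 * int m - 11)"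
  proof -
    have "(\<Sum>v\<in>V. (card (nn v))\<^sup>2) \<le> (\<Sum>v\<in>V. (degree (complement_graph G) v)\<^sup>2)"
    proof (intro sum_mono power_mono)
      fix v assume v: "v \<in> V"
      have "card (nn v) \<le> card (non_nbrs (parcs G) V v)"
        unfolding nn_def using fin sub
        by (intro card_mono non_nbrs_antimono) (auto simp: non_nbrs_def)
      then show "card (nn v) \<le> degree (complement_graph G) v"
        using degree_complement_graph[of v G] v by (simp add: V_def)
    qed simp
    also have "\<dots> = first_Zagreb (complement_graph G)"
      by (simp add: first_Zagreb_def V_def complement_graph_def)
    finally have "int (\<Sum>v\<in>V. (card (nn v))\<^sup>2) \<le> int (first_Zagreb (complement_graph G))"
      by (rule of_nat_mono)
    also have "\<dots> \<le> int m * (3 * int m - 11)" using assms(7) m(3) by simp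
    finally show ?thesis .
  qed
  obtain S where S: "S \<subseteq> V" "card S = k" "\<not> tree_with_leaves (parcs G) V S"
    using k_leaf_connectedI[OF G, of k] False assms(2,5) unfolding V_def by fastforce
  have finS: "finite S" using S(1) fin(1) finite_subset by blast
  have extreme: "\<exists>x y. x \<noteq> y \<and> x \<in> V - R \<and> y \<in> V - R \<and> card (nn x) = m - 2 \<and> card (nn y) = m - 2
      \<and> nn x \<subseteq> V - R \<and> nn y \<subseteq> V - R" if R: "R \<subseteq> S" "card R = k - 2" for R
  proof -
    let ?U = "V - R"
    have finR: "finite R" using R(1) finS finite_subset by blast
    have "card (S - R) = 2" using R S(2) finR assms(1) by (simp add: card_Diff_subset)
    then obtain a b where ab: "S - R = {a, b}" "a \<noteq> b" by (auto simp: card_2_iff)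
    have abS: "S = insert a (insert b R)" "a \<in> ?U" "b \<in> ?U" "a \<notin> R" "b \<notin> R"
      using ab R(1) S(1) by auto
    have cardU: "card ?U = m + 2"
      using R S(1) finR fin(2) m assms(1) by (subst card_Diff_subset) auto
    have "\<not> hamiltonian_path (parcs G) ?U a b"
      using tree_of_hamiltonian_path[OF G, of S a b R] abS ab(2) S degG unfolding V_def by fastforce
    moreover have "hamiltonian_path (parcs G) ?U a b" if "hamiltonian_path (parcs H) ?U a b"
    proof (rule hamiltonian_path_of_closure[OF steps G _ _ that])
      have loss: "card (parcs H `` {u} - ?U) \<le> k - 2" for u
      proof -
        have "parcs H `` {u} - ?U \<subseteq> R" using H.in_arcsD2 H(2) by auto
        then show ?thesis using card_mono[OF finR] R(2) by metis
      qed
      fix u v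
      show "card ?U + 1 + card (parcs H `` {u} - ?U) + card (parcs H `` {v} - ?U)
          \<le> n + k - 1 + (if {u, v} \<inter> {a, b} \<noteq> {} then 1 else 0)"
        using loss[of u] loss[of v] cardU m assms(1) by linarith
    qed (use cardU m in \<open>auto simp: V_def\<close>)
    ultimately have no_path: "\<not> hamiltonian_path (parcs H) ?U a b" by blast
    obtain x y where "x \<in> ?U" "y \<in> ?U" "x \<noteq> y" "card (nn x) = m - 2" "card (nn y) = m - 2"
        "nn x \<subseteq> ?U" "nn y \<subseteq> ?U"
      using two_extreme_codegrees[OF fin(1) symH irrH Diff_subset cardU m(1) abS(2,3) ab(2) no_path
          bound[unfolded nn_def] small[unfolded nn_def]]
      unfolding nn_def[symmetric] by blast
    then show ?thesis by blast
  qed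
  \<comment> \<open>For the shape of $H$ any choice of $R$ will do.\<close>
  obtain R0 where R0: "R0 \<subseteq> S" "card R0 = k - 2"
    using S(2) by (metis diff_le_self obtain_subset_with_card_n)
  obtain x y where xy: "x \<noteq> y" "x \<in> V" "y \<in> V" "card (nn x) = m - 2" "card (nn y) = m - 2"
    using extreme[OF R0] by auto
  obtain W where W: "W \<subseteq> V - {x, y}" "nn x - {y} = W" "nn y - {x} = W"
    and nnW: "\<And>w. w \<in> W \<Longrightarrow> nn w = {x, y}" and nnC: "\<And>v. v \<in> V - {x, y} - W \<Longrightarrow> nn v = {}"
    using two_extreme_codegrees_structure[OF fin(1) symH m(1) bound[unfolded nn_def]
        ore[unfolded nn_def] xy(2,3,1) xy(4,5)[unfolded nn_def]]
    unfolding nn_def[symmetric] by blast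
  define C where "C = V - {x, y} - W"
  have parts: "pverts H = C \<union> W \<union> {x, y}" "C \<inter> W = {}" "C \<inter> {x, y} = {}" "W \<inter> {x, y} = {}"
    using W(1) xy(2,3) H(2) by (auto simp: C_def)
  have finW: "finite W" using W(1) fin(1) by (meson finite_subset Diff_subset)
  have cardC: "card C + card W + 2 = n"
  proof -
    have "card (V - {x, y}) = n - 2" using xy fin by (simp add: card_Diff_subset)
    moreover have "card C = card (V - {x, y}) - card W"
      unfolding C_def using W(1) finW by (simp add: card_Diff_subset)
    moreover have "card W \<le> card (V - {x, y})" using W(1) fin(1) by (intro card_mono) auto
    ultimately show ?thesis using assms(2) by linarith
  qed
  have adj: "(u, v) \<in> parcs H \<longleftrightarrow> u \<noteq> v \<and> v \<notin> nn u" if "u \<in> V" "v \<in> V" for u v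
    using that irrH by (auto simp: nn_def non_nbrs_def irrefl_def)
  have sym_nn: "v \<in> nn u \<longleftrightarrow> u \<in> nn v" if "u \<in> V" "v \<in> V" for u v
    using that symH by (auto simp: nn_def non_nbrs_def dest: symD)
  have universal: "(u, v) \<in> parcs H" if "u \<in> C" "v \<in> pverts H" "u \<noteq> v" for u v
    using that adj[of u v] nnC[of u] H(2) by (auto simp: C_def)
  have clique: "(u, v) \<in> parcs H" if "u \<in> W" "v \<in> W" "u \<noteq> v" for u v
    using that adj[of u v] nnW[of u] W(1) by auto
  have apart: "(u, v) \<notin> parcs H" if "u \<in> W" "v \<in> {x, y}" for u v
    using that adj[of u v] nnW[of u] W(1) xy by auto
  show ?thesis
  proof (cases "(x, y) \<in> parcs H")
    case True
    then have "y \<notin> nn x" using adj[OF xy(2,3)] by blast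
    then have "nn x = W" using W(2) by blast
    then have cards: "card W = n - k - 2" "card C = k" using xy(4) cardC m by auto
    have "(y, x) \<in> parcs H" using True symH by (meson symD)
    have "digraph_iso (with_proj H) (with_proj (graph_join (complete_graph k)
        (graph_sum (complete_graph (n - k - 2)) (complete_graph 2))))"
    proof (rule digraph_iso_join_sum[OF H(1) pair_wf_digraph_complete_graph parts cards(2,1)])
      let ?g = "\<lambda>v. if v = x then 0 else 1 :: nat"
      show "bij_betw ?g {x, y} (pverts (complete_graph 2))"
        using xy(1) by (auto simp: bij_betw_def complete_graph_def)
      show "(u, v) \<in> parcs H \<longleftrightarrow> (?g u, ?g v) \<in> parcs (complete_graph 2)"
        if "u \<in> {x, y}" "v \<in> {x, y}" for u v
        using that True \<open>(y, x) \<in> parcs H\<close> irrH xy(1) by (auto simp: complete_graph_def irrefl_def)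
    qed (use universal clique apart in blast)+
    then show ?thesis unfolding H_def by blast
  next
    case nonadj: False
    then have yx: "y \<in> nn x" "x \<in> nn y" using adj[OF xy(2,3)] sym_nn[OF xy(2,3)] xy(1) by auto
    then have nn_xy: "nn x = insert y W" "nn y = insert x W" using W(2,3) by auto
    have "y \<notin> W" using W(1) by blast
    then have cards: "card W = n - k - 3" "card C = k + 1"
      using nn_xy(1) xy(4) cardC m finW by auto
    show ?thesis
    proof (cases "k = 2")
      case True
      have "(y, x) \<notin> parcs H" using nonadj symH by (meson symD)
      have "digraph_iso (with_proj H) (with_proj (graph_join (complete_graph 3)
          (graph_sum (complete_graph (n - 5)) (graph_copies 2 (complete_graph 1)))))"
      proof (rule digraph_iso_join_sum[OF H(1)
            pair_wf_digraph_graph_copies[OF pair_wf_digraph_complete_graph] parts])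
        let ?g = "\<lambda>v. (if v = x then 0 else 1 :: nat, 0 :: nat)"
        show "card C = 3" "card W = n - 5" using cards True by auto
        show "bij_betw ?g {x, y} (pverts (graph_copies 2 (complete_graph 1)))"
          using xy(1) by (auto simp: bij_betw_def complete_graph_def graph_copies_def)
        show "(u, v) \<in> parcs H \<longleftrightarrow> (?g u, ?g v) \<in> parcs (graph_copies 2 (complete_graph 1))"
          if "u \<in> {x, y}" "v \<in> {x, y}" for u v
          using that nonadj \<open>(y, x) \<notin> parcs H\<close> irrH
          by (auto simp: complete_graph_def graph_copies_def irrefl_def)
      qed (use universal clique apart in blast)+
      then show ?thesis unfolding H_def by blast
    next
      case False
      then have k3: "3 \<le> k" using assms(1) by simp
      have only_xy: "v \<in> {x, y}" if "v \<in> V" "card (nn v) = m - 2" for v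
      proof (rule ccontr)
        assume "v \<notin> {x, y}"
        then have "nn v = {x, y} \<or> nn v = {}" using that(1) nnW nnC by blast
        then have "card (nn v) \<le> 2" using xy(1) by auto
        then show False using that(2) m by simp
      qed
      \<comment> \<open>Since $k \<ge> 3$, each $s \<in> S$ lies in some $R$, and $R$ avoids the non-neighbours of $x$ and $y$.\<close>
      have "S \<subseteq> C"
      proof
        fix s assume s: "s \<in> S"
        have "k - 3 \<le> card (S - {s})" using S(2) s finS by simp
        then obtain R' where R': "R' \<subseteq> S - {s}" "card R' = k - 3"
          by (meson obtain_subset_with_card_n)
        have "finite R'" using R'(1) finS by (meson finite_subset Diff_subset)
        then have "card (insert s R') = k - 2" using R' k3 by (subst card_insert_disjoint) auto
        then obtain x' y' where x'y': "x' \<noteq> y'" "x' \<in> V - insert s R'" "y' \<in> V - insert s R'"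
            "card (nn x') = m - 2" "card (nn y') = m - 2"
            "nn x' \<subseteq> V - insert s R'" "nn y' \<subseteq> V - insert s R'"
          using extreme[of "insert s R'"] R'(1) s by blast
        then have "{x', y'} = {x, y}" using only_xy[of x'] only_xy[of y'] by blast
        then have "nn x \<subseteq> V - insert s R'" "nn y \<subseteq> V - insert s R'"
          using x'y'(6,7) by (auto simp: doubleton_eq_iff)
        then show "s \<in> C" using nn_xy s S(1) by (auto simp: C_def)
      qed
      then have "card (C - S) = 1" using cards(2) S(2) finS by (simp add: card_Diff_subset)
      then obtain c where c: "C - S = {c}" by (auto simp: card_1_singleton_iff)
      then have C_eq: "C = insert c S" "c \<notin> S" using \<open>S \<subseteq> C\<close> by auto
      \<comment> \<open>In $H$ the vertices $x$ and $y$ have $k + 1$ neighbours, the least degree allowed in $G$, so none of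
        these edges was added by the closure.\<close>
      have nbrs: "parcs G `` {z} = C" if z: "z \<in> {x, y}" for z
      proof (rule card_seteq)
        show "finite C" using C_eq finS by simp
        show "parcs G `` {z} \<subseteq> C"
        proof
          fix v assume "v \<in> parcs G `` {z}"
          then have "(z, v) \<in> parcs H" "v \<in> V" "z \<in> V"
            using sub G.in_arcsD1 G.in_arcsD2 by (auto simp: V_def)
          then have "v \<notin> nn z" "v \<noteq> z" using adj[of z v] by auto
          then show "v \<in> C" using z nn_xy \<open>v \<in> V\<close> by (auto simp: C_def)
        qed
        show "card C \<le> card (parcs G `` {z})"
          using degG[of z] z xy cards(2) by (auto simp: degree_eq_card)
      qed
      have "tree_with_leaves (parcs G) (pverts G) S"
      proof (rule spider_tree[OF G steps, of c S W x y])
        show "pverts G = insert c S \<union> W \<union> {x, y}" using parts(1) C_eq(1) H(2) V_def by simp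
        show "insert c S \<inter> W = {}" "{x, y} \<inter> (insert c S \<union> W) = {}"
          using parts(2-4) C_eq(1) by auto
        show "W \<noteq> {}" using cards(1) m by auto
        show "card W + 2 * card S + 2 \<le> n + k - 1" using cards(1) S(2) m by linarith
        show "non_nbrs (parcs H) (pverts G) w = {x, y}" if "w \<in> W" for w
          using nnW[OF that] by (simp add: nn_def V_def)
        show "non_nbrs (parcs H) (pverts G) v = {}" if "v \<in> insert c S" for v
          using nnC[OF that[folded C_eq(1), unfolded C_def]] by (simp add: nn_def V_def)
      qed (use C_eq xy(1) S(2) k3 nbrs in auto)
      then show ?thesis using S(3) by (simp add: V_def)
    qed
  qed
qed simp

end
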